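(* Let $d \ge 1$ be an integer and $\lambda>0$, and let $G$ be the Green's function of the network $\Gamma_d(\lambda)$. There exist four constants $c_1,c_2,c_3,c_4>0$ such that for all vertices $z=(n,x)\in\mathbb{Z}\times\mathbb{Z}^d$ with $z\neq 0$, $$G(0,z)\le c_1\begin{cases} e^{-c_2\|z\|} & \text{if } \|x\|>n,\\ e^{-c_2\frac{\|x\|^2}{n}}\,\|z\|^{-\frac d2} & \text{if } \|x\|\le n,\end{cases}$$ and $$G(0,z)\ge c_3\begin{cases} e^{-c_4\|z\|} & \text{if } \|x\|>n,\\ e^{-c_4\frac{\|x\|^2}{n}}\,\|z\|^{-\frac d2} & \text{if } \|x\|\le n.\end{cases}$$
   Context: $\Gamma_d(\lambda)$ is the nearest-neighbour lattice graph on $\mathbb{Z}^{d+1}=\mathbb{Z}\times\mathbb{Z}^d$ with conductance $\mu((n,x),(n',x'))=e^{\lambda\max(n,n')}$ on each edge $(n,x)\sim(n',x')$; $\lambda>0$ is fixed. The network random walk $(S_m)_{m\ge 0}$ is the Markov chain which from a vertex jumps to a neighbour with probability proportional to the conductance of the connecting edge; equivalently, its i.i.d. steps equal $(1,0)$ with probability $e^\lambda/(2d+1+e^\lambda)$ and each of the other $2d+1$ signed unit vectors with probability $1/(2d+1+e^\lambda)$. The Green's function is $G(z,z')=\sum_{m\ge 0}\mathbb{P}(S_m=z'\mid S_0=z)$. $\|\cdot\|$ is the Euclidean norm. Constants may depend on $d$ and $\lambda$ but not on $z$. *)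

theory Defs
  imports "HOL-Probability.Probability"
begin

type_synonym 'd vertex = "int \<times> (int ^ 'd)"

definition adjacent :: "'d::finite vertex \<Rightarrow> 'd vertex \<Rightarrow> bool" where
  "adjacent z w \<longleftrightarrow> \<bar>fst z - fst w\<bar> + (\<Sum>i\<in>UNIV. \<bar>snd z $ i - snd w $ i\<bar>) = 1"

definition neighbours :: "'d::finite vertex \<Rightarrow> 'd vertex set" where
  "neighbours z = {w. adjacent z w}"

text \<open>The conductance is extended by 0 to pairs of vertices that are not adjacent.\<close>

definition conductance :: "real \<Rightarrow> 'd::finite vertex \<Rightarrow> 'd vertex \<Rightarrow> real" where
  "conductance lam z w =
     (if adjacent z w then exp (lam * real_of_int (max (fst z) (fst w))) else 0)"

definition step :: "real \<Rightarrow> 'd::finite vertex \<Rightarrow> 'd vertex pmf" where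
  "step lam z =
     embed_pmf (\<lambda>w. conductance lam z w / (\<Sum>v\<in>neighbours z. conductance lam z v))"

text \<open>\<open>walk lam z m\<close> is the law of \<open>S\<^sub>m\<close> given \<open>S\<^sub>0 = z\<close>.\<close>

primrec walk :: "real \<Rightarrow> 'd::finite vertex \<Rightarrow> nat \<Rightarrow> 'd vertex pmf" where
  "walk lam z 0 = return_pmf z"
| "walk lam z (Suc m) = bind_pmf (walk lam z m) (step lam)"

text \<open>The value is an extended real, so that an upper bound includes convergence of the series.\<close>

definition green :: "real \<Rightarrow> 'd::finite vertex \<Rightarrow> 'd vertex \<Rightarrow> ennreal" where
  "green lam z w = (\<Sum>m. ennreal (pmf (walk lam z m) w))"

text \<open>Vertices are embedded in Euclidean space, where \<open>norm\<close> is the Euclidean norm,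
  also on the product type.\<close>

definition real_vec :: "int ^ 'd \<Rightarrow> real ^ 'd::finite" where
  "real_vec x = (\<chi> i. real_of_int (x $ i))"

definition real_vertex :: "'d::finite vertex \<Rightarrow> real \<times> (real ^ 'd)" where
  "real_vertex z = (real_of_int (fst z), real_vec (snd z))"


text \<open>The transition weights form a probability mass function, so \<open>embed_pmf\<close> is
  applied meaningfully in the definition of \<open>step\<close>.\<close>

lemma sum_abs_eq_1_cases:
  fixes f :: "'d::finite \<Rightarrow> int"
  assumes "(\<Sum>i\<in>UNIV. \<bar>f i\<bar>) = 1"
  obtains i where "\<bar>f i\<bar> = 1" "\<And>j. j \<noteq> i \<Longrightarrow> f j = 0"
proof -
  obtain i where i: "f i \<noteq> 0"
    using assms by (metis abs_zero sum.neutral zero_neq_one)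
  have split: "(\<Sum>j\<in>UNIV. \<bar>f j\<bar>) = \<bar>f i\<bar> + (\<Sum>j\<in>UNIV - {i}. \<bar>f j\<bar>)"
    by (simp add: sum.remove)
  have nonneg: "(\<Sum>j\<in>UNIV - {i}. \<bar>f j\<bar>) \<ge> 0"
    by (simp add: sum_nonneg)
  have abs_i: "\<bar>f i\<bar> = 1" and rest: "(\<Sum>j\<in>UNIV - {i}. \<bar>f j\<bar>) = 0"
    using assms i split nonneg by linarith+
  from rest have "\<forall>j\<in>UNIV - {i}. \<bar>f j\<bar> = 0"
    by (subst (asm) sum_nonneg_eq_0_iff) auto
  with abs_i show ?thesis
    by (intro that[of i]) auto
qed

lemma neighbours_eq:
  fixes x :: "int ^ 'd::finite"
  shows "neighbours (n, x) =
    {(n + 1, x), (n - 1, x)} \<union> (\<Union>i. {(n, x + axis i 1), (n, x - axis i 1)})"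
    (is "_ = ?R")
proof (intro set_eqI iffI)
  fix w assume "w \<in> neighbours (n, x)"
  then obtain n' y where w: "w = (n', y)"
    and sum1: "\<bar>n - n'\<bar> + (\<Sum>i\<in>UNIV. \<bar>x $ i - y $ i\<bar>) = 1"
    by (cases w) (auto simp: neighbours_def adjacent_def)
  have nonneg: "(\<Sum>i\<in>UNIV. \<bar>x $ i - y $ i\<bar>) \<ge> 0"
    by (simp add: sum_nonneg)
  consider "n = n'" "(\<Sum>i\<in>UNIV. \<bar>x $ i - y $ i\<bar>) = 1"
    | "\<bar>n - n'\<bar> = 1" "(\<Sum>i\<in>UNIV. \<bar>x $ i - y $ i\<bar>) = 0"
    using sum1 nonneg by linarith
  then show "w \<in> ?R"
  proof cases
    case 1
    from sum_abs_eq_1_cases[OF 1(2)] obtain i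
      where i: "\<bar>x $ i - y $ i\<bar> = 1" "\<And>j. j \<noteq> i \<Longrightarrow> x $ j - y $ j = 0" by blast
    from i(1) consider "y $ i = x $ i + 1" | "y $ i = x $ i - 1" by linarith
    then have "y = x + axis i 1 \<or> y = x - axis i 1"
    proof cases
      case 1
      with i(2) have "y = x + axis i 1" by (auto simp: vec_eq_iff axis_def)
      then show ?thesis ..
    next
      case 2
      with i(2) have "y = x - axis i 1" by (auto simp: vec_eq_iff axis_def)
      then show ?thesis ..
    qed
    then show ?thesis using w 1 by auto
  next
    case 2
    then have "y = x"
      by (subst (asm) sum_nonneg_eq_0_iff) (auto simp: vec_eq_iff)
    moreover have "n' = n + 1 \<or> n' = n - 1" using 2 by linarith
    ultimately show ?thesis using w by auto
  qed
next
  have ax: "(\<Sum>j\<in>UNIV. \<bar>axis i (1::int) $ j\<bar>) = 1" for i :: 'd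
    by (simp add: axis_def if_distrib cong: if_cong)
  fix w assume "w \<in> ?R"
  then show "w \<in> neighbours (n, x)"
    by (auto simp: neighbours_def adjacent_def ax)
qed

lemma finite_neighbours: "finite (neighbours z)"
  by (cases z) (simp add: neighbours_eq)

lemma neighbours_nonempty: "neighbours z \<noteq> {}"
  by (cases z) (simp add: neighbours_eq)

lemma conductance_pos: "w \<in> neighbours z \<Longrightarrow> conductance lam z w > 0"
  by (simp add: neighbours_def conductance_def)

lemma conductance_nonneg: "conductance lam z w \<ge> 0"
  by (simp add: conductance_def)

lemma total_conductance_pos: "(\<Sum>v\<in>neighbours z. conductance lam z v) > 0"
  by (intro sum_pos finite_neighbours neighbours_nonempty conductance_pos)

lemma pmf_step:
  "pmf (step lam z) w = conductance lam z w / (\<Sum>v\<in>neighbours z. conductance lam z v)"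
  unfolding step_def
proof (rule pmf_embed_pmf)
  let ?C = "\<Sum>v\<in>neighbours z. conductance lam z v"
  show nn: "0 \<le> conductance lam z v / ?C" for v
    using total_conductance_pos[of lam z] conductance_nonneg[of lam z v] by simp
  have "(\<integral>\<^sup>+ v. ennreal (conductance lam z v / ?C) \<partial>count_space UNIV)
      = (\<integral>\<^sup>+ v. ennreal (conductance lam z v / ?C) \<partial>count_space (neighbours z))"
    by (rule nn_integral_count_space_eq) (auto simp: neighbours_def conductance_def)
  also have "\<dots> = (\<Sum>v\<in>neighbours z. ennreal (conductance lam z v / ?C))"
    by (simp add: nn_integral_count_space_finite finite_neighbours)
  also have "\<dots> = ennreal (\<Sum>v\<in>neighbours z. conductance lam z v / ?C)"
    by (rule sum_ennreal) (rule nn)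
  also have "(\<Sum>v\<in>neighbours z. conductance lam z v / ?C) = 1"
    using total_conductance_pos[of lam z] by (simp flip: sum_divide_distrib)
  finally show "(\<integral>\<^sup>+ v. ennreal (conductance lam z v / ?C) \<partial>count_space UNIV) = 1"
    by simp
qed

end

theory Submission
  imports Defs
begin

text \<open>
  The partial sums of the Green's function satisfy a renewal equation, which is compared with
  supersolutions for the upper bounds.  Away from the cone, \<open>exp (- \<theta> \<cdot> z)\<close> is a supersolution as soon
  as the moment generating function of a step is below 1 at \<open>\<theta>\<close>.  Inside the cone, tilt the walk by a
  small \<open>\<theta>\<close> with moment generating function at most 1, which produces the Gaussian factor, and then take the
  discrete Fourier transform in the horizontal variable only.  At frequency \<open>\<eta>\<close> this leaves a
  one-dimensional upward drifting walk killed at a rate comparable to \<open>\<kappa> = \<Sum> sin\<^sup>2 \<eta>\<^sub>i\<close>, whose Green's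
  function at height \<open>n\<close> is at most \<open>C exp (- c \<kappa> n)\<close>; averaging over \<open>\<eta>\<close> gives \<open>n\<close> to the power \<open>- d / 2\<close>.

  For the lower bounds, the Green's function is a sum of multinomial probabilities over the vectors of
  step counts with the right displacement.  Inside the cone there are about \<open>\<surd>n\<close> to the power \<open>d + 1\<close>
  such vectors near the mean, and Stirling's formula bounds each probability from below.
\<close>

section \<open>The renewal equation\<close>

text \<open>\<open>None\<close> stands for the vertical coordinate, \<open>Some i\<close> for the
  i-th horizontal one, and the flag for the sign. The directions thus form a finite type, and sums
  over steps run over \<open>UNIV\<close>.\<close>

fun unit_step :: "'d::finite option \<times> bool \<Rightarrow> 'd vertex" where
  "unit_step (None, s) = (if s then 1 else - 1, 0)"
| "unit_step (Some i, s) = (0, axis i (if s then 1 else - 1))"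

text \<open>The total conductance at a vertex of height n, divided by exp (lam n).\<close>

definition weight_total :: "'d::finite itself \<Rightarrow> real \<Rightarrow> real" where
  "weight_total _ lam = 2 * real CARD('d) + 1 + exp lam"

definition step_prob :: "real \<Rightarrow> 'd::finite option \<times> bool \<Rightarrow> real" where
  "step_prob lam a = (if a = (None, True) then exp lam else 1) / weight_total TYPE('d) lam"

lemma weight_total_pos: "weight_total TYPE('d::finite) lam > 0"
  unfolding weight_total_def by (smt (verit) exp_gt_zero of_nat_0_le_iff)

lemma step_prob_pos: "step_prob lam a > 0"
  unfolding step_prob_def using weight_total_pos by auto

lemma sum_directions:
  fixes h :: "'d::finite option \<times> bool \<Rightarrow> 'b::comm_monoid_add"
  shows "(\<Sum>a\<in>UNIV. h a) =
    h (None, True) + h (None, False) + (\<Sum>i\<in>UNIV. h (Some i, True) + h (Some i, False))"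
proof -
  have "(\<Sum>a\<in>UNIV. h a) = (\<Sum>c\<in>UNIV. \<Sum>s\<in>UNIV. h (c, s))"
    by (simp add: sum.cartesian_product flip: UNIV_Times_UNIV)
  also have "\<dots> = (\<Sum>c\<in>UNIV. h (c, True) + h (c, False))"
    by (simp add: UNIV_bool add.commute)
  also have "\<dots> = h (None, True) + h (None, False) + (\<Sum>c\<in>range Some. h (c, True) + h (c, False))"
    by (simp add: UNIV_option_conv)
  finally show ?thesis by (simp add: sum.reindex)
qed

lemma sum_step_prob: "(\<Sum>a\<in>UNIV. step_prob lam (a :: 'd::finite option \<times> bool)) = 1"
proof -
  have "(\<Sum>a\<in>UNIV. step_prob lam (a :: 'd option \<times> bool)) =
      (exp lam + 1 + 2 * real CARD('d)) / weight_total TYPE('d) lam"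
    unfolding sum_directions by (simp add: step_prob_def add_divide_distrib)
  then show ?thesis
    using weight_total_pos[where 'd = 'd, of lam] by (simp add: weight_total_def)
qed

lemma neighbours_eq_range:
  "neighbours z = range (\<lambda>a. z - unit_step a)" "neighbours z = range (\<lambda>a. z + unit_step a)"
proof -
  obtain n x where z: "z = (n, x)" by force
  have UN: "UNIV = insert (None, True) (insert (None, False)
      (\<Union>i::'a. {(Some i, True), (Some i, False)}))"
  proof (rule set_eqI)
    fix a :: "'a option \<times> bool"
    show "a \<in> UNIV \<longleftrightarrow> a \<in> insert (None, True) (insert (None, False)
      (\<Union>i::'a. {(Some i, True), (Some i, False)}))"
      by (cases a rule: unit_step.cases) auto
  qed
  have ax: "axis i (- 1) = - axis i (1::int)" for i :: 'a
    by (simp add: vec_eq_iff axis_def)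
  show "neighbours z = range (\<lambda>a. z - unit_step a)"
    unfolding z neighbours_eq UN image_insert image_UN by (auto simp: ax)
  show "neighbours z = range (\<lambda>a. z + unit_step a)"
    unfolding z neighbours_eq UN image_insert image_UN by (auto simp: ax)
qed

lemma inj_unit_step: "inj unit_step"
proof (rule injI)
  fix a b :: "'a option \<times> bool" assume "unit_step a = unit_step b"
  then show "a = b"
    by (cases a rule: unit_step.cases; cases b rule: unit_step.cases)
      (auto simp: vec_eq_iff axis_def split: if_splits)
qed

lemma conductance_unit_step:
  "conductance lam (n, x) ((n, x) + unit_step a) =
     exp (lam * n) * (if a = (None, True) then exp lam else 1)"
proof -
  have "adjacent (n, x) ((n, x) + unit_step a)"
    using neighbours_eq_range(2)[of "(n, x)"] by (auto simp: neighbours_def)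
  then show ?thesis
    by (cases a rule: unit_step.cases) (auto simp: conductance_def algebra_simps exp_add)
qed

text \<open>The factor exp (lam n) cancels between a conductance and the total at the same vertex,
  so the step law does not depend on the position.\<close>

lemma pmf_step_unit_step: "pmf (step lam z) (z + unit_step a) = step_prob lam (a :: 'd::finite option \<times> bool)"
proof -
  obtain n x where z: "z = (n, x)" by force
  have "(\<Sum>v\<in>neighbours z. conductance lam z v) =
      (\<Sum>a\<in>UNIV. conductance lam z (z + unit_step (a :: 'd option \<times> bool)))"
    unfolding neighbours_eq_range(2) by (rule sum.reindex_cong) (auto intro!: injI dest: injD[OF inj_unit_step])
  also have "\<dots> = exp (lam * n) * weight_total TYPE('d) lam"
    unfolding z conductance_unit_step sum_directions
    by (simp add: weight_total_def algebra_simps)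
  finally show ?thesis
    unfolding pmf_step unfolding z conductance_unit_step by (simp add: step_prob_def)
qed

section \<open>Partial sums of the Green's function and comparison with supersolutions\<close>

definition partial_green :: "real \<Rightarrow> nat \<Rightarrow> 'd::finite vertex \<Rightarrow> real" where
  "partial_green lam N z = (\<Sum>m<N. pmf (walk lam 0 m) z)"

lemma partial_green_0 [simp]: "partial_green lam 0 z = 0"
  by (simp add: partial_green_def)

text \<open>Decomposition over the last step: only neighbours of \<open>z\<close> can precede it, so
  the integral is a finite sum.\<close>

lemma pmf_walk_Suc:
  fixes z :: "'d::finite vertex"
  shows "pmf (walk lam y (Suc m)) z = (\<Sum>a\<in>UNIV. step_prob lam a * pmf (walk lam y m) (z - unit_step a))"
proof -
  have "pmf (walk lam y (Suc m)) z = (\<integral>v. pmf (step lam v) z \<partial>walk lam y m)"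
    by (simp add: pmf_bind)
  also have "\<dots> = (\<Sum>v\<in>neighbours z. pmf (step lam v) z * pmf (walk lam y m) v)"
  proof (rule integral_measure_pmf_real)
    fix v assume "pmf (step lam v) z \<noteq> 0"
    then have "adjacent v z" by (auto simp: pmf_step conductance_def split: if_splits)
    then show "v \<in> neighbours z"
      by (auto simp: neighbours_def adjacent_def abs_minus_commute)
  qed (rule finite_neighbours)
  also have "\<dots> = (\<Sum>a\<in>UNIV. pmf (step lam (z - unit_step a)) z * pmf (walk lam y m) (z - unit_step (a :: 'd option \<times> bool)))"
    unfolding neighbours_eq_range(1) by (rule sum.reindex_cong) (auto intro!: injI dest: injD[OF inj_unit_step])
  also have "\<dots> = (\<Sum>a\<in>UNIV. step_prob lam a * pmf (walk lam y m) (z - unit_step a))"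
    using pmf_step_unit_step[of lam "z - unit_step a" a for a] by simp
  finally show ?thesis .
qed

lemma partial_green_Suc:
  "partial_green lam (Suc N) z =
     of_bool (z = 0) + (\<Sum>a\<in>UNIV. step_prob lam a * partial_green lam N (z - unit_step a))"
proof -
  have "partial_green lam (Suc N) z = of_bool (z = 0) + (\<Sum>m<N. pmf (walk lam 0 (Suc m)) z)"
    unfolding partial_green_def sum.lessThan_Suc_shift by (auto simp: indicator_def)
  also have "(\<Sum>m<N. pmf (walk lam 0 (Suc m)) z)
      = (\<Sum>a\<in>UNIV. step_prob lam a * partial_green lam N (z - unit_step a))"
    unfolding pmf_walk_Suc partial_green_def sum_distrib_left by (rule sum.swap)
  finally show ?thesis .
qed

lemma partial_green_nonneg: "partial_green lam N z \<ge> 0"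
  by (simp add: partial_green_def sum_nonneg)

text \<open>The extended-real series is the supremum of the real partial sums, so upper bounds
  uniform in \<open>N\<close> can be proved in the reals.\<close>

lemma green_le:
  assumes "\<And>N. partial_green lam N z \<le> c"
  shows "green lam 0 z \<le> ennreal c"
  unfolding green_def suminf_eq_SUP
proof (rule SUP_least)
  fix N
  have "(\<Sum>m<N. ennreal (pmf (walk lam 0 m) z)) = ennreal (partial_green lam N z)"
    by (simp add: partial_green_def sum_ennreal)
  then show "(\<Sum>m<N. ennreal (pmf (walk lam 0 m) z)) \<le> ennreal c"
    using assms ennreal_leI by metis
qed

lemma green_ge:
  assumes "c \<le> partial_green lam N z"
  shows "ennreal c \<le> green lam 0 z"
proof -
  have "ennreal c \<le> ennreal (partial_green lam N z)"
    using assms by (rule ennreal_leI)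
  also have "\<dots> = (\<Sum>m<N. ennreal (pmf (walk lam 0 m) z))"
    by (simp add: partial_green_def sum_ennreal)
  also have "\<dots> \<le> green lam 0 z"
    unfolding green_def by (intro sum_le_suminf) auto
  finally show ?thesis .
qed

text \<open>The renewal step is monotone because the weights are positive; starting from 0 \<le>
  \<open>H\<close>, induction on \<open>N\<close> keeps the partial sums below
  \<open>H\<close>.\<close>

lemma partial_green_le_supersolution:
  fixes H :: "'d::finite vertex \<Rightarrow> real"
  assumes super: "\<And>z. of_bool (z = 0) + (\<Sum>a\<in>UNIV. step_prob lam a * H (z - unit_step a)) \<le> H z"
    and nonneg: "\<And>z. H z \<ge> 0"
  shows "partial_green lam N z \<le> H z"
proof (induction N arbitrary: z)
  case (Suc N)
  have "partial_green lam (Suc N) z \<le> of_bool (z = 0) + (\<Sum>a\<in>UNIV. step_prob lam a * H (z - unit_step a))"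
    unfolding partial_green_Suc
    by (intro add_left_mono sum_mono mult_left_mono Suc less_imp_le[OF step_prob_pos])
  with super[of z] show ?case by linarith
qed (simp add: nonneg)

section \<open>Stirling bounds and multinomial probabilities\<close>

text \<open>The substitution s = exp t turns this into t \<le> sinh t for t \<ge> 0.\<close>

lemma ln_le_half_diff_inverse:
  fixes s :: real assumes "s \<ge> 1"
  shows "ln s \<le> (s - 1 / s) / 2"
proof -
  have "exp (ln s) = s" "ln s \<ge> 0" using assms by auto
  then show ?thesis using real_le_x_sinh[of "ln s"] by (simp only: inverse_eq_divide)
qed

text \<open>Write S n for the middle quantity. S n decreases from S 1 = 1, and S n - 1/(2n)
  increases from 1/2; this gives both bounds.\<close>

lemma ln_fact_bounds:
  fixes n :: nat
  assumes "n \<ge> 1"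
  shows "1 / 2 \<le> ln (fact n) - (n + 1 / 2) * ln n + n \<and> ln (fact n) - (n + 1 / 2) * ln n + n \<le> (1::real)"
proof -
  define S where "S n = ln (fact n) - (real n + 1 / 2) * ln n + n" for n :: nat
  have ln_quotient: "ln (1 + 1 / n) = ln (real n + 1) - ln n" if "n \<ge> 1" for n :: nat
  proof -
    have "1 + 1 / n = (real n + 1) / n" using that by (simp add: field_simps)
    then show ?thesis using that by (simp add: ln_divide_pos)
  qed
  have diff: "S (Suc n) - S n = 1 - (n + 1 / 2) * ln (1 + 1 / n)" if "n \<ge> 1" for n
  proof -
    have fact_eq: "ln (fact (Suc n) :: real) = ln (real n + 1) + ln (fact n)"
      by (simp add: ln_mult_pos add.commute del: fact_Suc of_nat_Suc add: fact_Suc[of n] of_nat_Suc)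
    show ?thesis
      unfolding S_def fact_eq ln_quotient[OF that] by (simp add: algebra_simps)
  qed
  have dec: "S (Suc n) \<le> S n" if "n \<ge> 1" for n
  proof -
    have "ln (1 + 1 / n) \<ge> 2 / (2 * real n + 1)"
      using ln_quotient[OF that] ln_inverse_approx_ge[of "real n" "real n + 1"] that by simp
    then have "2 \<le> ln (1 + 1 / n) * (2 * real n + 1)"
      by (subst (asm) pos_divide_le_eq) auto
    then have "1 \<le> (n + 1 / 2) * ln (1 + 1 / n)" by (simp add: algebra_simps)
    then show ?thesis using diff[OF that] by simp
  qed
  have inc: "S n - 1 / (2 * n) \<le> S (Suc n) - 1 / (2 * Suc n)" if "n \<ge> 1" for n
  proof -
    \<comment> \<open>With this square root, ln (1 + 1/n) = 2 ln s \<le> s - 1/s, whose square is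
      exactly \<open>u\<close>; and \<open>u / 2\<close> telescopes as 1/(2n) - 1/(2(n +
      1)).\<close>
    define s where "s = sqrt (1 + 1 / n)"
    define u where "u = 1 / (real n * (n + 1))"
    have s: "s \<ge> 1" "s\<^sup>2 = 1 + 1 / n" by (auto simp: s_def)
    have u: "u > 0" using that by (simp add: u_def)
    have "ln (s\<^sup>2) = 2 * ln s" using s(1) by (simp add: ln_realpow)
    also have "\<dots> \<le> s - 1 / s" using ln_le_half_diff_inverse[OF s(1)] by simp
    finally have "(n + 1 / 2) * ln (1 + 1 / n) \<le> (n + 1 / 2) * (s - 1 / s)"
      unfolding s(2) by (rule mult_left_mono) simp
    also have "\<dots> \<le> 1 + u / 2"
    proof (rule power2_le_imp_le)
      have qu: "real n * (n + 1) * u = 1" using that by (simp add: u_def)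
      have "(s - 1 / s)\<^sup>2 = s\<^sup>2 + 1 / s\<^sup>2 - 2"
        using s(1) by (simp add: power2_diff power_divide)
      also have "\<dots> = (n + 1) / n + n / (n + 1) - 2"
      proof -
        have "1 + 1 / n = (n + 1) / n" using that by (simp add: add_divide_distrib)
        then show ?thesis unfolding s(2) by simp
      qed
      also have "\<dots> = u"
      proof -
        have *: "(r + 1) / r + r / (r + 1) - 2 = 1 / (r * (r + 1))" if "r > 0" for r :: real
          using that by (simp add: divide_simps) (simp add: algebra_simps)
        show ?thesis using *[of "real n"] that by (simp add: u_def add.commute)
      qed
      finally have "((n + 1 / 2) * (s - 1 / s))\<^sup>2 = (n + 1 / 2)\<^sup>2 * u"
        by (simp add: power_mult_distrib)
      also have "(n + 1 / 2)\<^sup>2 = real n * (n + 1) + 1 / 4"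
        by (simp add: power2_eq_square algebra_simps)
      also have "(real n * (n + 1) + 1 / 4) * u = 1 + u / 4"
        using qu by (simp add: distrib_right)
      also have "\<dots> \<le> 1 + u + (u / 2)\<^sup>2" using u zero_le_power2[of "u / 2"] by linarith
      also have "\<dots> = (1 + u / 2)\<^sup>2" by (simp add: power2_sum)
      finally show "((n + 1 / 2) * (s - 1 / s))\<^sup>2 \<le> (1 + u / 2)\<^sup>2" .
    qed (use u in simp)
    finally have "S (Suc n) - S n \<ge> - (u / 2)" using diff[OF that] by simp
    moreover have "u / 2 = 1 / (2 * n) - 1 / (2 * Suc n)"
    proof -
      have *: "1 / (r * (r + 1)) / 2 = 1 / (2 * r) - 1 / (2 * (r + 1))" if "r > 0" for r :: real
        using that by (simp add: divide_simps)
      show ?thesis using *[of "real n"] that by (simp add: u_def add.commute)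
    qed
    ultimately show ?thesis by simp
  qed
  have "S n \<le> 1" using assms
  proof (induction n rule: dec_induct)
    case base show ?case by (simp add: S_def)
  next
    case (step n) then show ?case using dec[of n] by simp
  qed
  moreover have "1 / 2 \<le> S n - 1 / (2 * n)" using assms
  proof (induction n rule: dec_induct)
    case base show ?case by (simp add: S_def)
  next
    case (step n) then show ?case using inc[of n] by linarith
  qed
  moreover have "1 / (2 * real n) \<ge> 0" by simp
  ultimately have "1 / 2 \<le> S n" "S n \<le> 1" by linarith+
  then show ?thesis by (simp add: S_def)
qed

lemma stirling_formula_form:
  fixes n :: nat assumes "n \<ge> 1"
  shows "sqrt n * (n / exp 1) ^ n = exp ((n + 1 / 2) * ln n - n)"
proof -
  have "sqrt n = exp (ln n / 2)"
    using assms by (simp flip: ln_sqrt)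
  moreover have "exp (n * ln n - n) = (n / exp 1) ^ n"
  proof -
    have "n * ln n - n = n * (ln n - 1)" by (simp add: algebra_simps)
    then have "exp (n * ln n - n) = exp (ln n - 1) ^ n" by (simp only: exp_of_nat_mult)
    with assms show ?thesis by (simp add: exp_diff)
  qed
  moreover have "(n + 1 / 2) * ln n - n = ln n / 2 + (n * ln n - n)"
    by (simp add: algebra_simps)
  ultimately show ?thesis by (simp only: exp_add)
qed

lemma fact_ge_stirling: "sqrt n * (n / exp 1) ^ n \<le> fact n"
proof (cases "n = 0")
  case False
  then have "exp ((n + 1 / 2) * ln n - n) \<le> exp (ln (fact n))"
    using ln_fact_bounds[of n] by (intro exp_mono) linarith
  with False show ?thesis by (subst stirling_formula_form) auto
qed simp

text \<open>The \<open>n + 1\<close> under the root keeps the bound true at \<open>n = 0\<close>, so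
  it applies to every step count, zero included.\<close>

lemma fact_le_stirling: "fact n \<le> exp 1 * sqrt (n + 1) * (n / exp 1) ^ n"
proof (cases "n = 0")
  case False
  have "fact n = exp (ln (fact n :: real))" by simp
  also have "\<dots> \<le> exp (1 + ((n + 1 / 2) * ln n - n))"
    using ln_fact_bounds[of n] False by (intro exp_mono) linarith
  also have "\<dots> = exp 1 * (sqrt n * (n / exp 1) ^ n)"
    using False by (subst stirling_formula_form) (auto simp flip: exp_add)
  also have "\<dots> \<le> exp 1 * (sqrt (n + 1) * (n / exp 1) ^ n)"
    by (intro mult_left_mono mult_right_mono) auto
  finally show ?thesis by (simp add: mult.assoc add.commute)
qed simp

section \<open>Multinomial probabilities and step counts\<close>

definition multinomial_prob :: "('a::finite \<Rightarrow> real) \<Rightarrow> ('a \<Rightarrow> nat) \<Rightarrow> real" where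
  "multinomial_prob p k = fact (\<Sum>a\<in>UNIV. k a) * (\<Prod>a\<in>UNIV. p a ^ k a / fact (k a))"

text \<open>The exponent is the \<open>\<chi>\<^sup>2\<close>-divergence, which dominates the relative entropy that
  Stirling's formula produces.\<close>

lemma multinomial_prob_ge:
  fixes p :: "'a::finite \<Rightarrow> real" and k :: "'a \<Rightarrow> nat"
  assumes p: "\<And>a. p a > 0" and p1: "(\<Sum>a\<in>UNIV. p a) = 1"
    and M: "M = (\<Sum>a\<in>UNIV. k a)" "M \<ge> 1"
  shows "multinomial_prob p k \<ge>
    sqrt M / (exp 1 * sqrt (2 * M)) ^ CARD('a) * exp (- (\<Sum>a\<in>UNIV. (k a - M * p a)\<^sup>2 / (M * p a)))"
proof -
  let ?c = "exp 1 * sqrt (2 * real M)"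
  have Mpos: "real M > 0" using M(2) by simp
  have kM: "k a \<le> M" for a unfolding M by (rule member_le_sum) auto
  have factor: "exp (2 * k a - (k a)\<^sup>2 / (M * p a)) / ?c \<le> (real M * p a) ^ k a / fact (k a)" for a
  proof -
    have "exp (k a - (k a)\<^sup>2 / (M * p a)) * k a ^ k a \<le> (real M * p a) ^ k a"
    proof (cases "k a = 0")
      case False
      \<comment> \<open>The ratio of observed to expected count. The bound ln y \<le> y - 1 replaces
        the relative entropy by a quadratic expression in \<open>k a\<close>.\<close>
      define y where "y = k a / (M * p a)"
      have y: "y > 0" using False Mpos p[of a] by (simp add: y_def)
      have "exp (k a - (k a)\<^sup>2 / (M * p a)) = exp (k a * (1 - y))"
        by (simp add: y_def algebra_simps power2_eq_square)
      also have "\<dots> = exp (1 - y) ^ k a" by (simp add: exp_of_nat_mult)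
      also have "\<dots> \<le> exp (- ln y) ^ k a"
        using ln_le_minus_one[OF y] by (intro power_mono) auto
      also have "exp (- ln y) = M * p a / k a"
        using y by (simp add: exp_minus) (simp add: y_def)
      finally show ?thesis using False by (simp add: power_divide field_simps)
    qed simp
    then have "exp (k a - (k a)\<^sup>2 / (M * p a)) \<le> (real M * p a) ^ k a / k a ^ k a"
      by (cases "k a = 0") (auto simp: field_simps)
    then have "exp (k a) * exp (k a - (k a)\<^sup>2 / (M * p a)) / ?c \<le> exp (k a) * ((real M * p a) ^ k a / k a ^ k a) / ?c"
      using Mpos by (intro divide_right_mono mult_left_mono) auto
    also have "\<dots> = (real M * p a) ^ k a / (?c * (k a / exp 1) ^ k a)"
      by (simp add: power_divide mult_ac flip: exp_of_nat_mult)
    also have "\<dots> \<le> (real M * p a) ^ k a / fact (k a)"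
    proof (rule divide_left_mono)
      have "(k a / exp 1) ^ k a > 0" by (cases "k a = 0") auto
      then show "0 < ?c * (k a / exp 1) ^ k a * fact (k a)" using Mpos by simp
      \<comment> \<open>Since \<open>k a\<close> \<le> \<open>M\<close> and \<open>M\<close> \<ge>
        1, the root of \<open>k a + 1\<close> is at most that of 2M, and one constant
        \<open>?c\<close> serves all directions.\<close>
      have "fact (k a) \<le> exp 1 * sqrt (real (k a) + 1) * (k a / exp 1) ^ k a" by (rule fact_le_stirling)
      also have "\<dots> \<le> ?c * (k a / exp 1) ^ k a"
        using kM[of a] M(2) by (intro mult_right_mono mult_left_mono) auto
      finally show "fact (k a) \<le> ?c * (k a / exp 1) ^ k a" .
    qed (use Mpos p[of a] in simp)
    finally show ?thesis by (simp add: flip: exp_add)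
  qed
  have MM: "(\<Prod>a\<in>UNIV. real M ^ k a) = real M ^ M"
    unfolding M(1) by (rule power_sum[symmetric])
  have "sqrt M / ?c ^ CARD('a) * exp (- (\<Sum>a\<in>UNIV. (k a - M * p a)\<^sup>2 / (M * p a)))
      = sqrt M * exp (- M) * (\<Prod>a\<in>UNIV. exp (2 * k a - (k a)\<^sup>2 / (M * p a)) / ?c)"
  proof -
    \<comment> \<open>Expanding the squares and summing with total probability 1 leaves a single M,
      the source of the factor exp (- M).\<close>
    have "(k a - M * p a)\<^sup>2 / (M * p a) = (k a)\<^sup>2 / (M * p a) - 2 * k a + M * p a" for a
      using Mpos p[of a] by (simp add: field_simps power2_eq_square)
    then have "(\<Sum>a\<in>UNIV. (k a - M * p a)\<^sup>2 / (M * p a))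
        = (\<Sum>a\<in>UNIV. (k a)\<^sup>2 / (M * p a) - 2 * k a) + M"
      by (simp add: sum.distrib p1 flip: sum_distrib_left)
    then have "- (\<Sum>a\<in>UNIV. (k a - M * p a)\<^sup>2 / (M * p a))
        = - M + (\<Sum>a\<in>UNIV. 2 * k a - (k a)\<^sup>2 / (M * p a))"
      by (simp flip: sum_negf)
    then show ?thesis
      by (simp only: exp_add exp_sum[OF finite] prod_dividef) (simp add: mult_ac)
  qed
  also have "\<dots> \<le> sqrt M * exp (- M) * (\<Prod>a\<in>UNIV. (real M * p a) ^ k a / fact (k a))"
    using factor Mpos by (intro mult_left_mono prod_mono) auto
  also have "\<dots> = sqrt M * (exp (- M) * real M ^ M) * (\<Prod>a\<in>UNIV. p a ^ k a / fact (k a))"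
    by (simp add: power_mult_distrib prod_dividef prod.distrib MM)
  also have "exp (- M) * real M ^ M = (M / exp 1) ^ M"
    using exp_of_nat_mult[of M "1 :: real"] by (simp add: power_divide exp_minus field_simps)
  also have "sqrt M * (M / exp 1) ^ M * (\<Prod>a\<in>UNIV. p a ^ k a / fact (k a))
      \<le> fact M * (\<Prod>a\<in>UNIV. p a ^ k a / fact (k a))"
    using fact_ge_stirling[of M] p by (intro mult_right_mono prod_nonneg) (auto intro: less_imp_le)
  finally show ?thesis by (simp add: multinomial_prob_def flip: M(1))
qed

lemma prod_fact_le_fact_sum:
  fixes k :: "'a \<Rightarrow> nat" assumes "finite A"
  shows "(\<Prod>a\<in>A. fact (k a)) \<le> (fact (\<Sum>a\<in>A. k a) :: real)"
  using assms
proof (induction rule: finite_induct)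
  case (insert x A)
  have "(\<Prod>a\<in>insert x A. fact (k a)) = fact (k x) * (\<Prod>a\<in>A. fact (k a) :: real)"
    using insert by simp
  also have "\<dots> \<le> fact (k x) * fact (\<Sum>a\<in>A. k a)"
    by (intro mult_left_mono insert.IH) auto
  also have "\<dots> = real (fact (k x) * fact (\<Sum>a\<in>A. k a))" by simp
  also have "\<dots> \<le> real (fact (k x + (\<Sum>a\<in>A. k a)))"
    by (intro of_nat_mono dvd_imp_le fact_fact_dvd_fact) auto
  finally show ?case using insert by simp
qed simp

text \<open>The multinomial coefficient is at least 1, which amounts to keeping one path with these
  counts.\<close>

lemma multinomial_prob_ge_prod:
  fixes p :: "'a::finite \<Rightarrow> real"
  assumes "\<And>a. p a \<ge> 0"
  shows "multinomial_prob p k \<ge> (\<Prod>a\<in>UNIV. p a ^ k a)"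
proof -
  have "(\<Prod>a\<in>UNIV. p a ^ k a) = (\<Prod>a\<in>UNIV. fact (k a)) * (\<Prod>a\<in>UNIV. p a ^ k a / fact (k a))"
    by (simp flip: prod.distrib)
  also have "\<dots> \<le> fact (\<Sum>a\<in>UNIV. k a) * (\<Prod>a\<in>UNIV. p a ^ k a / fact (k a))"
    using assms by (intro mult_right_mono prod_fact_le_fact_sum prod_nonneg) auto
  finally show ?thesis by (simp add: multinomial_prob_def)
qed

text \<open>Conditioning on one step: the term for \<open>a\<close> is the fraction k a / M of the
  left-hand side, where M is the total count. Restricting to \<open>k a > 0\<close> guards against
  truncated subtraction.\<close>

lemma multinomial_prob_rec:
  fixes p :: "'a::finite \<Rightarrow> real"
  assumes "k \<noteq> (\<lambda>_. 0)"
  shows "multinomial_prob p k = (\<Sum>a\<in>{a. k a > 0}. p a * multinomial_prob p (k(a := k a - 1)))"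
proof -
  let ?M = "\<Sum>a\<in>UNIV. k a"
  let ?P = "\<Prod>a\<in>UNIV. p a ^ k a / fact (k a)"
  from assms obtain b where "k b > 0" by (auto simp: fun_eq_iff)
  then have M: "?M > 0" by (subst sum_pos2[of _ b]) auto
  have step: "p a * multinomial_prob p (k(a := k a - 1)) = fact (?M - 1) * ?P * k a" if "k a > 0" for a
  proof -
    have s: "(\<Sum>b\<in>UNIV. (k(a := k a - 1)) b) = ?M - 1"
      using that by (simp add: sum.remove[of UNIV a])
    have "?P = p a ^ k a / fact (k a) * (\<Prod>b\<in>UNIV - {a}. p b ^ k b / fact (k b))"
      by (simp add: prod.remove[of UNIV a])
    moreover have "p a * (\<Prod>b\<in>UNIV. p b ^ (k(a := k a - 1)) b / fact ((k(a := k a - 1)) b))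
       = p a ^ k a / fact (k a) * k a * (\<Prod>b\<in>UNIV - {a}. p b ^ k b / fact (k b))"
      using that by (cases "k a") (auto simp: prod.remove[of UNIV a] simp del: of_nat_Suc)
    ultimately show ?thesis unfolding multinomial_prob_def s
      by (metis (no_types, lifting) ab_semigroup_mult_class.mult_ac(1) mult.commute)
  qed
  have "(\<Sum>a\<in>{a. k a > 0}. p a * multinomial_prob p (k(a := k a - 1)))
      = (\<Sum>a\<in>{a. k a > 0}. fact (?M - 1) * ?P * k a)"
    by (intro sum.cong refl step) simp
  also have "\<dots> = (\<Sum>a\<in>UNIV. fact (?M - 1) * ?P * k a)"
    by (rule sum.mono_neutral_left) auto
  also have "\<dots> = fact (?M - 1) * ?P * ?M"
    by (simp add: sum_distrib_left)
  also have "\<dots> = fact ?M * ?P"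
    using M by (simp add: fact_reduce[of ?M])
  finally show ?thesis by (simp add: multinomial_prob_def)
qed

text \<open>A path with \<open>k a\<close> steps in each direction \<open>a\<close> ends at \<open>displacement k\<close>.\<close>

definition displacement :: "('d::finite option \<times> bool \<Rightarrow> nat) \<Rightarrow> 'd vertex" where
  "displacement k = (int (k (None, True)) - int (k (None, False)),
     \<chi> i. int (k (Some i, True)) - int (k (Some i, False)))"

lemma displacement_decrement:
  assumes "k a > 0"
  shows "displacement (k(a := k a - 1)) = displacement k - unit_step a"
  using assms
  by (cases a rule: unit_step.cases)
    (auto simp: displacement_def vec_eq_iff axis_def of_nat_diff)

text \<open>Distinct count vectors describe disjoint sets of paths to \<open>z\<close>. The
  induction matches the multinomial recursion with the renewal equation instead of enumerating
  paths.\<close>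

lemma sum_multinomial_prob_le_partial_green:
  assumes "finite A" "\<And>k. k \<in> A \<Longrightarrow> displacement k = z" "\<And>k. k \<in> A \<Longrightarrow> (\<Sum>a\<in>UNIV. k a) < N"
  shows "(\<Sum>k\<in>A. multinomial_prob (step_prob lam) k) \<le> partial_green lam N z"
  using assms
proof (induction N arbitrary: A z)
  case 0
  then have "A = {}" by auto
  then show ?case by simp
next
  case (Suc N)
  let ?T = "multinomial_prob (step_prob lam)"
  let ?d = "\<lambda>a k. k(a := k a - 1 :: nat)"
  define B where "B a = {k \<in> A - {\<lambda>_. 0}. k a > 0}" for a
  have "(\<Sum>k\<in>A. ?T k) = (\<Sum>k\<in>A \<inter> {\<lambda>_. 0}. ?T k) + (\<Sum>k\<in>A - {\<lambda>_. 0}. ?T k)"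
    using Suc.prems(1) by (subst sum.union_disjoint[symmetric]) (auto intro!: sum.cong)
  \<comment> \<open>The zero vector is the empty path and contributes the source term of the renewal
    equation.\<close>
  also have "(\<Sum>k\<in>A \<inter> {\<lambda>_. 0}. ?T k) \<le> of_bool (z = 0)"
  proof (cases "(\<lambda>_. 0) \<in> A")
    case True
    then have "A \<inter> {\<lambda>_. 0} = {\<lambda>_. 0}" by auto
    moreover from Suc.prems(2)[OF True] have "z = 0"
      by (auto simp: displacement_def zero_prod_def vec_eq_iff)
    ultimately show ?thesis by (simp add: multinomial_prob_def)
  qed simp
  also have "(\<Sum>k\<in>A - {\<lambda>_. 0}. ?T k) = (\<Sum>k\<in>A - {\<lambda>_. 0}. \<Sum>a\<in>{a. k a > 0}. step_prob lam a * ?T (?d a k))"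
    by (intro sum.cong multinomial_prob_rec) auto
  also have "\<dots> = (\<Sum>a\<in>UNIV. \<Sum>k\<in>B a. step_prob lam a * ?T (?d a k))"
    unfolding B_def using Suc.prems(1) by (subst sum.swap_restrict) auto
  also have "\<dots> \<le> (\<Sum>a\<in>UNIV. step_prob lam a * partial_green lam N (z - unit_step a))"
  proof (rule sum_mono)
    fix a :: "'a option \<times> bool"
    \<comment> \<open>All vectors in \<open>B a\<close> have a positive entry at \<open>a\<close>,
      so lowering it loses no information.\<close>
    have inj: "inj_on (?d a) (B a)"
    proof (rule inj_onI)
      fix k l assume kl: "k \<in> B a" "l \<in> B a" "?d a k = ?d a l"
      have "k b = l b" for b
        using fun_cong[OF kl(3), of b] kl(1,2) by (cases "b = a") (auto simp: B_def)
      then show "k = l" ..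
    qed
    have "(\<Sum>k\<in>B a. ?T (?d a k)) = (\<Sum>k\<in>?d a ` B a. ?T k)"
      unfolding sum.reindex[OF inj] by simp
    also have "\<dots> \<le> partial_green lam N (z - unit_step a)"
    proof (rule Suc.IH)
      show "finite (?d a ` B a)" using Suc.prems(1) by (simp add: B_def)
    next
      fix k' assume "k' \<in> ?d a ` B a"
      then obtain k where k: "k \<in> A" "k a > 0" "k' = ?d a k" by (auto simp: B_def)
      show "displacement k' = z - unit_step a"
        using displacement_decrement[of k a] Suc.prems(2) k by simp
      have "(\<Sum>b\<in>UNIV. k' b) < (\<Sum>b\<in>UNIV. k b)"
        using k by (intro sum_strict_mono_ex1 ballI bexI[of _ a]) auto
      with Suc.prems(3)[OF k(1)] show "(\<Sum>b\<in>UNIV. k' b) < N" by simp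
    qed
    finally show "(\<Sum>k\<in>B a. step_prob lam a * ?T (?d a k)) \<le> step_prob lam a * partial_green lam N (z - unit_step a)"
      unfolding sum_distrib_left[symmetric] by (intro mult_left_mono less_imp_le[OF step_prob_pos])
  qed
  finally show ?case by (simp add: partial_green_Suc)
qed

section \<open>Lower bounds\<close>

text \<open>The probability of each step other than the upward one.\<close>

definition rest_prob :: "'d::finite itself \<Rightarrow> real \<Rightarrow> real" where
  "rest_prob _ lam = 1 / weight_total TYPE('d) lam"

lemma rest_prob_pos: "rest_prob TYPE('d::finite) lam > 0"
  by (simp add: rest_prob_def weight_total_pos)

lemma step_prob_eq:
  "step_prob lam (a :: 'd::finite option \<times> bool) =
     (if a = (None, True) then exp lam else 1) * rest_prob TYPE('d) lam"
  by (simp add: step_prob_def rest_prob_def)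

lemma rest_prob_le_step_prob:
  assumes "lam > 0"
  shows "rest_prob TYPE('d::finite) lam \<le> step_prob lam (a :: 'd option \<times> bool)"
  using assms rest_prob_pos[where 'd = 'd, of lam] by (auto simp: step_prob_eq)

lemma step_prob_le_1: "step_prob lam (a :: 'd::finite option \<times> bool) \<le> 1"
proof -
  have "step_prob lam a \<le> (\<Sum>b\<in>UNIV. step_prob lam (b :: 'd option \<times> bool))"
    by (rule member_le_sum) (auto intro: less_imp_le[OF step_prob_pos])
  then show ?thesis by (simp add: sum_step_prob)
qed

text \<open>The mean vertical displacement of one step.\<close>

definition drift :: "'d::finite itself \<Rightarrow> real \<Rightarrow> real" where
  "drift _ lam = (exp lam - 1) * rest_prob TYPE('d) lam"

lemma drift_pos: "lam > 0 \<Longrightarrow> drift TYPE('d::finite) lam > 0"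
  by (simp add: drift_def rest_prob_pos)

fun coordinate :: "'d::finite vertex \<Rightarrow> 'd option \<Rightarrow> int" where
  "coordinate z None = fst z"
| "coordinate z (Some i) = snd z $ i"

lemma abs_coordinate_le_norm: "\<bar>real_of_int (coordinate z c)\<bar> \<le> norm (real_vertex z)"
proof (cases c)
  case None
  then show ?thesis using norm_fst_le[of "real_of_int (fst z)" "real_vec (snd z)"] by (simp add: real_vertex_def)
next
  case (Some i)
  have "\<bar>real_of_int (snd z $ i)\<bar> \<le> norm (real_vec (snd z))"
    using component_le_norm_cart[of "real_vec (snd z)" i] by (simp add: real_vec_def)
  also have "\<dots> \<le> norm (real_vertex z)"
    using norm_snd_le[of "real_vec (snd z)" "real_of_int (fst z)"] by (simp add: real_vertex_def)
  finally show ?thesis using Some by simp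
qed

text \<open>In every coordinate, \<open>v + t\<close> steps in each direction cancel; only the excess moves the walk.\<close>

definition path_counts ::
    "'d::finite vertex \<Rightarrow> nat \<Rightarrow> ('d option \<Rightarrow> nat) \<Rightarrow> 'd option \<times> bool \<Rightarrow> nat" where
  "path_counts z v t = (\<lambda>(c, s). v + t c + nat (if s then coordinate z c else - coordinate z c))"

lemma displacement_path_counts: "displacement (path_counts z v t) = z"
  by (cases z) (simp add: displacement_def path_counts_def vec_eq_iff)

text \<open>One shortest path suffices: its length is the l1-norm of z, at most d + 1 times the
  Euclidean norm, and each step has probability at least \<open>rest_prob\<close>.\<close>

lemma green_ge_exp:
  assumes "lam > 0"
  shows "\<exists>c>0. \<forall>z :: 'd::finite vertex. green lam 0 z \<ge> ennreal (exp (- c * norm (real_vertex z)))"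
proof -
  let ?q = "rest_prob TYPE('d) lam"
  define c where "c = (real CARD('d) + 1) * (1 - ln ?q)"
  have q: "0 < ?q" "?q \<le> 1"
    using rest_prob_pos rest_prob_le_step_prob[OF assms, of undefined] step_prob_le_1 order.trans by blast+
  have lnq: "ln ?q \<le> 0" using q by simp
  then have c: "c > 0" unfolding c_def by (intro mult_pos_pos) auto
  have "green lam 0 z \<ge> ennreal (exp (- c * norm (real_vertex z)))" for z :: "'d vertex"
  proof -
    define k where "k = path_counts z 0 (\<lambda>_. 0)"
    let ?M = "\<Sum>a\<in>UNIV. k a"
    have k2: "k (c, True) + k (c, False) = nat \<bar>coordinate z c\<bar>" for c
      by (simp add: k_def path_counts_def)
    have M: "?M = (\<Sum>c\<in>UNIV. nat \<bar>coordinate z c\<bar>)"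
      unfolding sum_directions k2 by (simp add: UNIV_option_conv sum.reindex)
    have "real ?M = (\<Sum>c\<in>UNIV. \<bar>real_of_int (coordinate z c)\<bar>)"
      unfolding M by (simp add: of_nat_nat)
    also have "\<dots> \<le> real CARD('d option) * norm (real_vertex z)"
      using sum_bounded_above[of UNIV "\<lambda>c. \<bar>real_of_int (coordinate z c)\<bar>" "norm (real_vertex z)"]
      by (simp add: abs_coordinate_le_norm)
    finally have Mle: "real ?M \<le> (real CARD('d) + 1) * norm (real_vertex z)" by (simp add: add.commute)
    have "exp (- c * norm (real_vertex z)) \<le> exp (real ?M * ln ?q)"
    proof (intro exp_mono)
      have "(real CARD('d) + 1) * norm (real_vertex z) * ln ?q \<le> real ?M * ln ?q"
        using Mle lnq by (rule mult_right_mono_neg)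
      moreover have "0 \<le> (real CARD('d) + 1) * norm (real_vertex z)" by simp
      moreover have "- c * norm (real_vertex z) = (real CARD('d) + 1) * norm (real_vertex z) * ln ?q
          - (real CARD('d) + 1) * norm (real_vertex z)"
        unfolding c_def by (simp add: algebra_simps)
      ultimately show "- c * norm (real_vertex z) \<le> real ?M * ln ?q" by linarith
    qed
    also have "\<dots> = ?q ^ ?M" using q by (simp only: exp_of_nat_mult exp_ln)
    also have "\<dots> = (\<Prod>a\<in>UNIV. ?q ^ k a)" by (rule power_sum)
    also have "\<dots> \<le> (\<Prod>a\<in>UNIV. step_prob lam a ^ k a)"
      using q rest_prob_le_step_prob[OF assms] by (intro prod_mono) (auto intro!: power_mono)
    also have "\<dots> \<le> multinomial_prob (step_prob lam) k"
      by (intro multinomial_prob_ge_prod less_imp_le[OF step_prob_pos])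
    also have "\<dots> = (\<Sum>k\<in>{k}. multinomial_prob (step_prob lam) k)" by simp
    also have "\<dots> \<le> partial_green lam (Suc ?M) z"
      by (rule sum_multinomial_prob_le_partial_green) (auto simp: k_def displacement_path_counts)
    finally show ?thesis by (rule green_ge)
  qed
  with c show ?thesis by blast
qed

text \<open>At least n to the power (d + 1)/2 count vectors are admissible, and each has probability
  of order at least n to the power 1/2 - (d + 1) times the Gaussian factor. The product has order n
  to the power -d/2.\<close>

lemma green_ge_gaussian:
  assumes "lam > 0"
  shows "\<exists>c>0. \<exists>c'>0. \<forall>n. \<forall>x :: int ^ 'd::finite. 1 \<le> n \<longrightarrow> norm (real_vec x) \<le> real_of_int n \<longrightarrow>
    green lam 0 (n, x) \<ge> ennreal (c * (exp (- c' * (norm (real_vec x))\<^sup>2 / real_of_int n)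
      / sqrt n ^ CARD('d)))"
proof -
  let ?q = "rest_prob TYPE('d) lam" and ?\<delta> = "drift TYPE('d) lam"
  \<comment> \<open>\<open>r\<close> is the number of directions, \<open>B\<close> collects the
    constants of the \<chi>-squared sum, and \<open>K\<close> bounds path lengths by
    \<open>K * n\<close>: the mean length is n divided by the drift, and the deviation is at most 3
    r n.\<close>
  define r where "r = 2 * (real CARD('d) + 1)"
  define B where "B = r * (1 + r)\<^sup>2 / ?q"
  define K where "K = 1 / ?\<delta> + 3 * r"
  define D where "D = CARD('d) + 1"
  have q: "?q > 0" by (rule rest_prob_pos)
  have \<delta>: "?\<delta> > 0" by (rule drift_pos[OF assms])
  have r: "r > 0" "r = CARD('d option \<times> bool)" by (auto simp: r_def)
  have B: "B > 0" and K: "K > 0" using q \<delta> r by (auto simp: B_def K_def intro!: add_pos_pos)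
  have "green lam 0 (n, x) \<ge> ennreal (exp (- 8 * B) / (2 * (exp 1)\<^sup>2 * K) ^ D
      * (exp (- (2 * B) * (norm (real_vec x))\<^sup>2 / n) / sqrt n ^ CARD('d)))"
    if n: "1 \<le> n" and xn: "norm (real_vec x) \<le> real_of_int n" for n and x :: "int ^ 'd"
  proof -
    define R where "R = norm (real_vec x)"
    \<comment> \<open>\<open>L\<close> is the mean time to climb to height n, \<open>v\<close> the
      rounded mean number of steps in each non-upward direction by then, and \<open>l\<close> the
      range of each free parameter \<open>t c\<close>.\<close>
    define L where "L = n / ?\<delta>"
    define v where "v = nat \<lfloor>L * ?q\<rfloor>"
    define l where "l = nat \<lfloor>sqrt n\<rfloor>"
    define E where "E = 2 * sqrt n + R"
    define A where "A = path_counts (n, x) v ` (PiE UNIV (\<lambda>_. {..l}))"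
    define b where "b = exp (- 8 * B) * exp (- (2 * B) * R\<^sup>2 / n) * (sqrt n / (2 * (exp 1)\<^sup>2 * (K * n)) ^ D)"
    have L: "L > 0" using n \<delta> by (simp add: L_def)
    have sqrtn: "sqrt n \<ge> 1" "sqrt n \<le> n"
      using n by (auto intro!: real_le_lsqrt self_le_power)
    have R: "R \<ge> 0" "R \<le> n" using xn by (auto simp: R_def)
    have E: "E \<ge> 0" "E \<le> 3 * n" using sqrtn R by (auto simp: E_def)
    have E2: "E\<^sup>2 \<le> 8 * n + 2 * R\<^sup>2"
    proof -
      have "E\<^sup>2 \<le> 2 * (2 * sqrt n)\<^sup>2 + 2 * R\<^sup>2"
        using zero_le_power2[of "2 * sqrt n - R"] by (simp add: E_def power2_diff power2_sum)
      also have "(2 * sqrt n)\<^sup>2 = 4 * n" using n by (simp add: power_mult_distrib)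
      finally show ?thesis by simp
    qed
    have xR: "\<bar>real_of_int (x $ i)\<bar> \<le> R" for i
      using component_le_norm_cart[of "real_vec x" i] by (simp add: R_def real_vec_def)
    have v: "L * ?q - 1 \<le> v" "v \<le> L * ?q"
      using L q by (auto simp: v_def of_nat_nat)
    have l: "real l \<le> sqrt n" "sqrt n \<le> real l + 1"
      using sqrtn by (auto simp: l_def of_nat_nat)
    have bound: "b \<le> multinomial_prob (step_prob lam) k \<and> (\<Sum>a\<in>UNIV. k a) < Suc (nat \<lceil>K * n\<rceil>)"
      if k: "k \<in> A" for k
    proof -
      let ?M = "\<Sum>a\<in>UNIV. k a"
      from k obtain t where kt: "k = path_counts (n, x) v t" and t: "\<And>c. t c \<le> l"
        by (auto simp: A_def)
      have t': "real (t c) \<le> sqrt n" for c using t[of c] l(1) by linarith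
      \<comment> \<open>The rounding error of \<open>v\<close> is at most 1 \<le> sqrt n,
        \<open>t\<close> is at most sqrt n, and the horizontal excess is at most \<open>R\<close>.
        The upward excess n is exactly \<open>L\<close> times the drift.\<close>
      have dev: "\<bar>k a - L * step_prob lam a\<bar> \<le> E" for a
      proof (cases "a = (None, True)")
        case True
        have "L * step_prob lam a = L * ?q + L * ?\<delta>"
          using True by (simp add: step_prob_eq drift_def algebra_simps)
        also have "L * ?\<delta> = n" using \<delta> by (simp add: L_def)
        finally have "L * step_prob lam a = L * ?q + n" .
        moreover have "real (k a) = v + t None + n"
          using True n by (simp add: kt path_counts_def of_nat_nat)
        ultimately show ?thesis using v t'[of None] sqrtn R unfolding E_def by linarith
      next
        case False
        obtain c s where a: "a = (c, s)" by force
        define w where "w = nat (if s then coordinate (n, x) c else - coordinate (n, x) c)"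
        have "real w \<le> R"
        proof (cases c)
          case None
          then show ?thesis using False a n R by (auto simp: w_def)
        next
          case (Some i)
          then have "real w \<le> \<bar>real_of_int (x $ i)\<bar>" by (auto simp: w_def)
          with xR[of i] show ?thesis by linarith
        qed
        moreover have "real (k a) = v + t c + w" by (simp add: kt a path_counts_def w_def)
        moreover have "L * step_prob lam a = L * ?q" using False by (simp add: step_prob_eq)
        ultimately show ?thesis using v t'[of c] sqrtn R unfolding E_def by linarith
      qed
      \<comment> \<open>The path length differs from \<open>L\<close>; as the probabilities sum to
        1, the difference is the sum of the individual deviations.\<close>
      have "real ?M - L = (\<Sum>a\<in>UNIV. k a - L * step_prob lam a)"
        by (simp add: sum_subtractf sum_step_prob flip: sum_distrib_left)
      also have "\<bar>\<dots>\<bar> \<le> (\<Sum>a\<in>(UNIV :: ('d option \<times> bool) set). E)"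
        by (rule order.trans[OF sum_abs sum_mono[OF dev]])
      also have "\<dots> = r * E" by (simp add: r)
      finally have dev_M: "\<bar>real ?M - L\<bar> \<le> r * E" .
      have "real_of_int n \<le> real (k (None, True))" using n by (simp add: kt path_counts_def)
      also have "\<dots> \<le> real ?M" by (intro of_nat_mono member_le_sum) auto
      finally have nM: "n \<le> real ?M" .
      have "1 \<le> real ?M" using nM n by linarith
      then have M1: "1 \<le> ?M" by (simp only: real_of_nat_ge_one_iff)
      have M_le: "real ?M \<le> K * n"
      proof -
        have "r * E \<le> r * (3 * n)" using E r by (intro mult_left_mono) auto
        with dev_M show ?thesis by (simp add: K_def L_def algebra_simps)
      qed
      have "(\<Sum>a\<in>UNIV. (k a - ?M * step_prob lam a)\<^sup>2 / (?M * step_prob lam a)) \<le>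
          (\<Sum>a\<in>(UNIV :: ('d option \<times> bool) set). ((1 + r) * E)\<^sup>2 / (n * ?q))"
      proof (rule sum_mono, rule frac_le)
        fix a :: "'d option \<times> bool"
        have "\<bar>?M * step_prob lam a - L * step_prob lam a\<bar> = \<bar>real ?M - L\<bar> * step_prob lam a"
          using step_prob_pos[of lam a] by (simp add: abs_mult flip: left_diff_distrib)
        also have "\<dots> \<le> r * E * 1"
          using dev_M step_prob_pos[of lam a] step_prob_le_1[of lam a] by (intro mult_mono) auto
        finally have "\<bar>k a - ?M * step_prob lam a\<bar> \<le> (1 + r) * E"
          using dev[of a] by (simp add: algebra_simps)
        then show "(k a - ?M * step_prob lam a)\<^sup>2 \<le> ((1 + r) * E)\<^sup>2"
          by (metis abs_ge_zero power2_abs power_mono)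
        show "0 < n * ?q" using n q by simp
        show "n * ?q \<le> ?M * step_prob lam a"
          using nM n q rest_prob_le_step_prob[OF assms, of a] by (intro mult_mono) auto
      qed simp
      also have "\<dots> = B * (E\<^sup>2 / n)"
        unfolding sum_constant r(2)[symmetric] B_def power_mult_distrib by (simp add: mult_ac)
      also have "\<dots> \<le> B * ((8 * n + 2 * R\<^sup>2) / n)"
        using E2 n B by (intro mult_left_mono divide_right_mono) auto
      also have "\<dots> = 8 * B + (2 * B) * R\<^sup>2 / n" using n by (simp add: field_simps)
      finally have chi: "(\<Sum>a\<in>UNIV. (k a - ?M * step_prob lam a)\<^sup>2 / (?M * step_prob lam a))
          \<le> 8 * B + (2 * B) * R\<^sup>2 / n" .
      have "b = sqrt n / (2 * (exp 1)\<^sup>2 * (K * n)) ^ D * exp (- (8 * B + (2 * B) * R\<^sup>2 / n))"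
        unfolding b_def by (simp add: exp_add exp_minus exp_diff divide_inverse)
      also have "\<dots> \<le> sqrt ?M / (2 * (exp 1)\<^sup>2 * ?M) ^ D *
          exp (- (\<Sum>a\<in>UNIV. (k a - ?M * step_prob lam a)\<^sup>2 / (?M * step_prob lam a)))"
        using chi nM M_le n K
        by (intro mult_mono frac_le power_mono mult_left_mono) auto
      also have "(2 * (exp 1)\<^sup>2 * real ?M) ^ D = (exp 1 * sqrt (2 * real ?M)) ^ CARD('d option \<times> bool)"
      proof -
        have "2 * (exp 1)\<^sup>2 * real ?M = (exp 1 * sqrt (2 * real ?M))\<^sup>2"
          unfolding power_mult_distrib by (subst real_sqrt_pow2) (auto intro: sum_nonneg)
        moreover have "CARD('d option \<times> bool) = 2 * D" by (simp add: D_def)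
        ultimately show ?thesis by (simp only: power_mult)
      qed
      also have "sqrt ?M / (exp 1 * sqrt (2 * real ?M)) ^ CARD('d option \<times> bool) *
          exp (- (\<Sum>a\<in>UNIV. (k a - ?M * step_prob lam a)\<^sup>2 / (?M * step_prob lam a)))
          \<le> multinomial_prob (step_prob lam) k"
        using M1 by (intro multinomial_prob_ge step_prob_pos sum_step_prob refl)
      finally show ?thesis using M_le by linarith
    qed
    have inj: "inj (path_counts (n, x) v)"
    proof (rule injI)
      fix s t assume "path_counts (n, x) v s = path_counts (n, x) v t"
      then have "path_counts (n, x) v s (c, True) = path_counts (n, x) v t (c, True)" for c by simp
      then show "s = t" by (auto simp: path_counts_def)
    qed
    have cardA: "card A = (l + 1) ^ D"
      unfolding A_def by (subst card_image) (auto intro: inj_on_subset[OF inj] simp: card_PiE D_def)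
    have finA: "finite A" unfolding A_def by (intro finite_imageI finite_PiE) auto
    have b: "b \<ge> 0" using n K by (simp add: b_def)
    \<comment> \<open>With D = d + 1, the powers of sqrt n combine to D + 1 - 2D = -d.\<close>
    have "exp (- 8 * B) / (2 * (exp 1)\<^sup>2 * K) ^ D
      * (exp (- (2 * B) * (norm (real_vec x))\<^sup>2 / n) / sqrt n ^ CARD('d)) = sqrt n ^ D * b"
    proof -
      have "(real_of_int n) ^ D = sqrt n ^ D * sqrt n ^ D"
        using n by (simp flip: power_mult_distrib)
      moreover have "sqrt n ^ D = sqrt n ^ CARD('d) * sqrt n" by (simp add: D_def)
      moreover have "sqrt n > 0" using sqrtn by linarith
      ultimately show ?thesis
        by (simp add: b_def R_def power_mult_distrib)
    qed
    also have "\<dots> \<le> real (l + 1) ^ D * b"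
      using l b sqrtn by (intro mult_right_mono power_mono) auto
    also have "\<dots> = (\<Sum>k\<in>A. b)" by (simp add: cardA)
    also have "\<dots> \<le> (\<Sum>k\<in>A. multinomial_prob (step_prob lam) k)"
      using bound by (intro sum_mono) blast
    also have "\<dots> \<le> partial_green lam (Suc (nat \<lceil>K * n\<rceil>)) (n, x)"
    proof (rule sum_multinomial_prob_le_partial_green[OF finA])
      show "displacement k = (n, x)" if "k \<in> A" for k
        using that by (auto simp: A_def displacement_path_counts)
    qed (use bound in blast)
    finally show ?thesis by (rule green_ge)
  qed
  moreover have "exp (- 8 * B) / (2 * (exp 1)\<^sup>2 * K) ^ D > 0" using K by simp
  ultimately show ?thesis using B by (intro exI[of _ "exp (- 8 * B) / (2 * (exp 1)\<^sup>2 * K) ^ D"] conjI exI[of _ "2 * B"]) auto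
qed

section \<open>Exponential tilting\<close>

text \<open>For t = -u < 0, exp (-u) \<le> 1/(1 + u), and (1 - u + u^2)(1 + u) = 1 + u^3 \<ge>
  1.\<close>

lemma exp_le_quadratic:
  fixes t :: real assumes "\<bar>t\<bar> \<le> 1"
  shows "exp t \<le> 1 + t + t\<^sup>2"
proof (cases "t \<ge> 0")
  case True
  then show ?thesis using assms exp_bound by simp
next
  case False
  define u where "u = - t"
  have u: "u > 0" using False by (simp add: u_def)
  have "exp (- u) \<le> 1 / (1 + u)"
    using exp_ge_add_one_self[of u] u by (simp add: exp_minus divide_inverse le_imp_inverse_le)
  also have "\<dots> \<le> 1 - u + u\<^sup>2"
  proof -
    have "(1 - u + u\<^sup>2) * (1 + u) = 1 + u ^ 3" by (simp add: algebra_simps power2_eq_square power3_eq_cube)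
    then have "1 \<le> (1 - u + u\<^sup>2) * (1 + u)" using u by simp
    then show ?thesis using u by (simp add: pos_divide_le_eq)
  qed
  finally show ?thesis by (simp add: u_def)
qed

text \<open>The inner product of z with \<theta> = (-a, b); a positive \<open>a\<close> penalises
  upward steps.\<close>

definition tilt :: "real \<Rightarrow> real ^ 'd \<Rightarrow> 'd::finite vertex \<Rightarrow> real" where
  "tilt a b z = (\<Sum>i\<in>UNIV. b $ i * snd z $ i) - a * fst z"

lemma tilt_scaled: "tilt a (c *\<^sub>R real_vec x) (n, x) = c * (norm (real_vec x))\<^sup>2 - a * n"
proof -
  have "(norm (real_vec x))\<^sup>2 = (\<Sum>i\<in>UNIV. (real_of_int (x $ i))\<^sup>2)"
    by (simp add: norm_vec_def L2_set_def sum_nonneg real_vec_def)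
  then show ?thesis
    by (simp add: tilt_def real_vec_def sum_distrib_left power2_eq_square mult_ac)
qed

lemma tilt_diff: "tilt a b (z - w) = tilt a b z - tilt a b w"
  by (simp add: tilt_def algebra_simps sum_subtractf)

lemma tilt_0 [simp]: "tilt a b 0 = 0"
  by (simp add: tilt_def)

lemma tilt_unit_step:
  "tilt a b (unit_step (None, s)) = (if s then - a else a)"
  "tilt a b (unit_step (Some i, s)) = (if s then b $ i else - (b $ i))"
  by (simp_all add: tilt_def axis_def if_distrib cong: if_cong)

text \<open>The sum over all directions is the moment generating function of a step at \<theta>. The
  weights stay unnormalised; a total below 1 acts as killing.\<close>

definition tilted_weight :: "real \<Rightarrow> real \<Rightarrow> real ^ 'd \<Rightarrow> 'd::finite option \<times> bool \<Rightarrow> real" where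
  "tilted_weight lam a b d = step_prob lam d * exp (tilt a b (unit_step d))"

lemma tilted_weight_pos: "tilted_weight lam a b d > 0"
  by (simp add: tilted_weight_def step_prob_pos)

text \<open>Second-order expansion: the horizontal first-order terms cancel by symmetry, and the
  vertical one leaves the drift. The second-order coefficients are probabilities of pairs of
  directions, hence at most 1.\<close>

lemma sum_tilted_weight_le:
  fixes b :: "real ^ 'd::finite"
  assumes "\<bar>a\<bar> \<le> 1" "norm b \<le> 1"
  shows "(\<Sum>d\<in>UNIV. tilted_weight lam a b d) \<le> 1 - drift TYPE('d) lam * a + a\<^sup>2 + (norm b)\<^sup>2"
proof -
  let ?q = "rest_prob TYPE('d) lam"
  have bi: "\<bar>b $ i\<bar> \<le> 1" for i
    using component_le_norm_cart[of b i] assms(2) by linarith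
  have q: "?q > 0" by (rule rest_prob_pos)
  have total: "exp lam * ?q + ?q + 2 * real CARD('d) * ?q = 1"
    using sum_step_prob[of lam, where 'd = 'd] unfolding sum_directions by (simp add: step_prob_eq)
  have "1 * ?q \<le> real CARD('d) * ?q" using q by (intro mult_right_mono) auto
  moreover have "exp lam * ?q > 0" using q by simp
  ultimately have q2: "2 * ?q \<le> 1" "exp lam * ?q + ?q \<le> 1" using total q by linarith+
  have "(\<Sum>d\<in>UNIV. tilted_weight lam a b d) =
      exp lam * ?q * exp (- a) + ?q * exp a + (\<Sum>i\<in>UNIV. ?q * (exp (b $ i) + exp (- (b $ i))))"
    unfolding sum_directions tilted_weight_def tilt_unit_step by (simp add: step_prob_eq algebra_simps)
  also have "\<dots> \<le> exp lam * ?q * (1 - a + a\<^sup>2) + ?q * (1 + a + a\<^sup>2) + (\<Sum>i\<in>UNIV. ?q * (2 + 2 * (b $ i)\<^sup>2))"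
  proof (intro add_mono mult_left_mono)
    show "exp (- a) \<le> 1 - a + a\<^sup>2" "exp a \<le> 1 + a + a\<^sup>2"
      using exp_le_quadratic[of a] exp_le_quadratic[of "- a"] assms by auto
    have "exp (b $ i) + exp (- (b $ i)) \<le> 2 + 2 * (b $ i)\<^sup>2" for i
      using exp_le_quadratic[of "b $ i"] exp_le_quadratic[of "- (b $ i)"] bi[of i] by auto
    then show "(\<Sum>i\<in>UNIV. ?q * (exp (b $ i) + exp (- (b $ i)))) \<le> (\<Sum>i\<in>UNIV. ?q * (2 + 2 * (b $ i)\<^sup>2))"
      using q by (intro sum_mono mult_left_mono) auto
  qed (use q in auto)
  also have "(\<Sum>i\<in>UNIV. ?q * (2 + 2 * (b $ i)\<^sup>2)) = 2 * real CARD('d) * ?q + 2 * ?q * (norm b)\<^sup>2"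
  proof -
    have "(norm b)\<^sup>2 = (\<Sum>i\<in>UNIV. (b $ i)\<^sup>2)"
      by (simp add: norm_vec_def L2_set_def sum_nonneg)
    then show ?thesis by (simp add: sum.distrib distrib_left mult_ac flip: sum_distrib_left)
  qed
  also have "exp lam * ?q * (1 - a + a\<^sup>2) + ?q * (1 + a + a\<^sup>2) + (2 * real CARD('d) * ?q + 2 * ?q * (norm b)\<^sup>2)
      = (exp lam * ?q + ?q + 2 * real CARD('d) * ?q) - drift TYPE('d) lam * a
        + (exp lam * ?q + ?q) * a\<^sup>2 + 2 * ?q * (norm b)\<^sup>2"
    by (simp add: drift_def algebra_simps)
  also have "\<dots> \<le> 1 - drift TYPE('d) lam * a + 1 * a\<^sup>2 + 1 * (norm b)\<^sup>2"
    unfolding total using q2 by (intro add_mono mult_right_mono) auto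
  finally show ?thesis by simp
qed

lemma drift_bounds:
  assumes "lam > 0"
  shows "drift TYPE('d::finite) lam \<le> 1" "drift TYPE('d) lam \<le> lam"
proof -
  have "drift TYPE('d) lam \<le> (exp lam - 1) * (1 / exp lam)"
    unfolding drift_def rest_prob_def weight_total_def using assms
    by (intro mult_left_mono divide_left_mono mult_pos_pos) (auto intro!: add_nonneg_pos)
  also have "\<dots> = 1 - exp (- lam)" by (simp add: exp_minus divide_inverse algebra_simps)
  finally have "drift TYPE('d) lam \<le> 1 - exp (- lam)" .
  then show "drift TYPE('d) lam \<le> 1" "drift TYPE('d) lam \<le> lam"
    using exp_ge_add_one_self[of "- lam"] exp_gt_zero[of "- lam"] by linarith+
qed

text \<open>One renewal step multiplies exp (- \<open>tilt\<close>) by at most 1 - \<epsilon>. After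
  division by \<epsilon>, the slack at the origin is 1 and pays for the source.\<close>

lemma green_le_tilt:
  fixes b :: "real ^ 'd::finite"
  assumes "(\<Sum>d\<in>UNIV. tilted_weight lam a b d) \<le> 1 - \<epsilon>" "\<epsilon> > 0"
  shows "green lam 0 z \<le> ennreal (exp (- tilt a b z) / \<epsilon>)"
proof (rule green_le, rule partial_green_le_supersolution)
  fix z :: "'d vertex"
  let ?S = "\<Sum>d\<in>UNIV. tilted_weight lam a b d"
  have "(\<Sum>d\<in>UNIV. step_prob lam d * (exp (- tilt a b (z - unit_step d)) / \<epsilon>)) = ?S * (exp (- tilt a b z) / \<epsilon>)"
    unfolding sum_distrib_right
    by (intro sum.cong) (auto simp: tilted_weight_def tilt_diff exp_diff exp_minus field_simps)
  also have "\<dots> \<le> (1 - \<epsilon>) * (exp (- tilt a b z) / \<epsilon>)"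
    using assms by (intro mult_right_mono) auto
  also have "\<dots> = exp (- tilt a b z) / \<epsilon> - exp (- tilt a b z)"
    using assms by (simp add: field_simps)
  also have "\<dots> \<le> exp (- tilt a b z) / \<epsilon> - of_bool (z = 0)"
    by simp
  finally show "of_bool (z = 0) + (\<Sum>d\<in>UNIV. step_prob lam d * (exp (- tilt a b (z - unit_step d)) / \<epsilon>))
      \<le> exp (- tilt a b z) / \<epsilon>" by linarith
qed (use assms in simp)

lemma green_le_exp:
  assumes "lam > 0"
  shows "\<exists>c>0. \<exists>c'>0. \<forall>n. \<forall>x :: int ^ 'd::finite. norm (real_vec x) > real_of_int n \<longrightarrow>
    green lam 0 (n, x) \<le> ennreal (c * exp (- c' * norm (real_vertex (n, x))))"
proof -
  let ?\<delta> = "drift TYPE('d) lam"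
  \<comment> \<open>With horizontal tilt 2a, the exponent in the moment bound is -
    \<open>?\<delta>\<close> a + 5 a^2, which is smallest at this value of a.\<close>
  define a where "a = ?\<delta> / 10"
  have \<delta>: "0 < ?\<delta>" "?\<delta> \<le> 1" using drift_pos drift_bounds assms by blast+
  have a: "a > 0" using \<delta> by (simp add: a_def)
  have "green lam 0 (n, x) \<le> ennreal (20 / ?\<delta>\<^sup>2 * exp (- (a / 2) * norm (real_vertex (n, x))))"
    if nx: "norm (real_vec x) > real_of_int n" for n and x :: "int ^ 'd"
  proof -
    let ?R = "norm (real_vec x)"
    \<comment> \<open>A tilt of length 2a towards x. For x = 0 the division by zero yields
      \<open>b = 0\<close>, and the formula for the tilt persists.\<close>
    define b where "b = (2 * a / ?R) *\<^sub>R real_vec x"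
    have nb: "norm b \<le> 2 * a" using a by (simp add: b_def)
    have "(\<Sum>d\<in>UNIV. tilted_weight lam a b d) \<le> 1 - ?\<delta> * a + a\<^sup>2 + (norm b)\<^sup>2"
      by (rule sum_tilted_weight_le) (use nb \<delta> in \<open>auto simp: a_def\<close>)
    also have "\<dots> \<le> 1 - ?\<delta> * a + a\<^sup>2 + (2 * a)\<^sup>2"
      using nb by (intro add_left_mono power_mono) auto
    also have "\<dots> = 1 - ?\<delta>\<^sup>2 / 20" by (simp add: a_def power2_eq_square field_simps)
    finally have "green lam 0 (n, x) \<le> ennreal (exp (- tilt a b (n, x)) / (?\<delta>\<^sup>2 / 20))"
      by (rule green_le_tilt) (use \<delta> in simp)
    also have "exp (- tilt a b (n, x)) / (?\<delta>\<^sup>2 / 20) = 20 / ?\<delta>\<^sup>2 * exp (- tilt a b (n, x))" by simp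
    also have "tilt a b (n, x) = 2 * a * ?R - a * n"
      unfolding b_def tilt_scaled by (simp add: power2_eq_square)
    also have "ennreal (20 / ?\<delta>\<^sup>2 * exp (- (2 * a * ?R - a * n)))
        \<le> ennreal (20 / ?\<delta>\<^sup>2 * exp (- (a / 2) * norm (real_vertex (n, x))))"
    proof (intro ennreal_leI mult_left_mono exp_mono)
      have "norm (real_vertex (n, x)) \<le> \<bar>real_of_int n\<bar> + ?R"
        using norm_Pair_le[of "real_of_int n" "real_vec x"] by (simp add: real_vertex_def)
      also have "\<dots> \<le> 2 * (2 * ?R - n)"
      proof -
        have "\<bar>N\<bar> + R \<le> 2 * (2 * R - N)" if "N < R" "0 \<le> R" for N R :: real
          using that by (cases "N \<ge> 0") auto
        then show ?thesis using nx norm_ge_zero by blast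
      qed
      finally have "a / 2 * norm (real_vertex (n, x)) \<le> a / 2 * (2 * (2 * ?R - n))"
        using a by (intro mult_left_mono) auto
      then show "- (2 * a * ?R - a * n) \<le> - (a / 2) * norm (real_vertex (n, x))"
        by (simp add: algebra_simps)
    qed simp
    finally show ?thesis .
  qed
  then show ?thesis
    using a \<delta> by (intro exI[of _ "20 / ?\<delta>\<^sup>2"] conjI exI[of _ "a / 2"]) auto
qed

section \<open>Horizontal Fourier transform\<close>

text \<open>The horizontal Fourier transform, at one frequency, of the partial Green's function of a tilted
  walk; \<open>\<rho>\<close> is the transform of its horizontal steps.\<close>

primrec vertical_transform :: "real \<Rightarrow> real \<Rightarrow> complex \<Rightarrow> nat \<Rightarrow> int \<Rightarrow> complex" where
  "vertical_transform wp wm \<rho> 0 n = 0"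
| "vertical_transform wp wm \<rho> (Suc N) n = of_bool (n = 0) + of_real wp * vertical_transform wp wm \<rho> N (n - 1)
     + of_real wm * vertical_transform wp wm \<rho> N (n + 1) + \<rho> * vertical_transform wp wm \<rho> N n"

text \<open>The right-hand side is a supersolution of the one-dimensional recursion:
  \<open>up\<close>, \<open>down\<close> and \<open>zero\<close> are the conditions at n > 0, n < 0
  and n = 0, the slack 1/C absorbing the source.\<close>

lemma norm_vertical_transform_le:
  assumes w: "wp \<ge> 0" "wm \<ge> 0" "cmod \<rho> \<le> r" and C: "C > 0" and \<alpha>: "\<alpha> > 0"
    and up: "wp * exp s + wm * exp (- s) + r \<le> 1"
    and down: "wp * \<alpha> + wm / \<alpha> + r \<le> 1"
    and zero: "wp * \<alpha> + wm * exp (- s) + r \<le> 1 - 1 / C"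
  shows "cmod (vertical_transform wp wm \<rho> N n) \<le> C * (if n \<ge> 0 then exp (- s * n) else \<alpha> ^ nat (- n))"
proof -
  define H where "H n = C * (if n \<ge> 0 then exp (- s * real_of_int n) else \<alpha> ^ nat (- n))" for n :: int
  have Hpos: "H n \<ge> 0" for n using C \<alpha> by (simp add: H_def)
  have H_up: "H (n + 1) = exp (- s) * H n" if "n \<ge> 0" for n
    using that by (simp add: H_def algebra_simps flip: exp_add)
  have H_down: "H (n - 1) = \<alpha> * H n" if "n \<le> 0" for n
  proof -
    have "nat (- (n - 1)) = Suc (nat (- n))" using that by simp
    then have "\<alpha> ^ nat (- (n - 1)) = \<alpha> * \<alpha> ^ nat (- n)" by (simp only: power_Suc)
    with that show ?thesis by (cases "n = 0") (auto simp: H_def)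
  qed
  have super: "of_bool (n = 0) + wp * H (n - 1) + wm * H (n + 1) + r * H n \<le> H n" for n
  proof -
    consider "n \<ge> 1" | "n = 0" | "n \<le> - 1" by linarith
    then show ?thesis
    proof cases
      case 1
      have "H (n - 1) = exp s * H n"
        using H_up[of "n - 1"] 1 by (simp add: exp_minus)
      then have "of_bool (n = 0) + wp * H (n - 1) + wm * H (n + 1) + r * H n
          = (wp * exp s + wm * exp (- s) + r) * H n"
        using 1 H_up[of n] by (simp add: algebra_simps)
      also have "\<dots> \<le> 1 * H n" using up Hpos by (rule mult_right_mono)
      finally show ?thesis by simp
    next
      case 2
      have H0: "H 0 = C" by (simp add: H_def)
      have "of_bool (n = 0) + wp * H (n - 1) + wm * H (n + 1) + r * H n
          = 1 + (wp * \<alpha> + wm * exp (- s) + r) * C"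
        using 2 H_up[of 0] H_down[of 0] by (simp add: H0 algebra_simps)
      also have "\<dots> \<le> 1 + (1 - 1 / C) * C" using zero C by (intro add_left_mono mult_right_mono) auto
      also have "\<dots> = C" using C by (simp add: field_simps)
      finally show ?thesis using 2 H0 by simp
    next
      case 3
      have "H (n + 1) = H n / \<alpha>"
        using H_down[of "n + 1"] 3 \<alpha> by simp
      then have "of_bool (n = 0) + wp * H (n - 1) + wm * H (n + 1) + r * H n
          = (wp * \<alpha> + wm / \<alpha> + r) * H n"
        using 3 H_down[of n] by (simp add: algebra_simps)
      also have "\<dots> \<le> 1 * H n" using down Hpos by (rule mult_right_mono)
      finally show ?thesis by simp
    qed
  qed
  have "cmod (vertical_transform wp wm \<rho> N n) \<le> H n"
  proof (induction N arbitrary: n)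
    case (Suc N)
    let ?v = "vertical_transform wp wm \<rho> N"
    have "cmod (vertical_transform wp wm \<rho> (Suc N) n)
        \<le> cmod (of_bool (n = 0)) + cmod (of_real wp * ?v (n - 1)) + cmod (of_real wm * ?v (n + 1)) + cmod (\<rho> * ?v n)"
      unfolding vertical_transform.simps
      by (intro order.trans[OF norm_triangle_ineq] add_mono order.refl)
    also have "\<dots> \<le> of_bool (n = 0) + wp * H (n - 1) + wm * H (n + 1) + r * H n"
      using w unfolding norm_mult
      by (intro add_mono mult_mono Suc.IH) (auto intro: order.trans[OF norm_ge_zero])
    also have "\<dots> \<le> H n" by (rule super)
    finally show ?case .
  qed (simp add: Hpos)
  then show ?thesis by (simp add: H_def)
qed

text \<open>The squared modulus is (A + B)^2 - 4 A B (sin t)^2, and A, B \<ge> m give 4 A B \<ge> 2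
  (A + B) m. At t = pi the modulus is again A + B, so the loss has to vanish there, as (sin t)^2
  does.\<close>

lemma norm_cis_combination_le:
  fixes A B m t :: real
  assumes "m > 0" "A \<ge> m" "B \<ge> m"
  shows "cmod (of_real A * cis t + of_real B * cis (- t)) \<le> A + B - m * (sin t)\<^sup>2"
proof (rule power2_le_imp_le)
  have sc: "(cos t)\<^sup>2 = 1 - (sin t)\<^sup>2" by (simp add: cos_squared_eq)
  have s1: "(sin t)\<^sup>2 \<le> 1" by (simp add: power_le_one_iff abs_square_le_1)
  have "(cmod (of_real A * cis t + of_real B * cis (- t)))\<^sup>2
      = ((A + B) * cos t)\<^sup>2 + ((A - B) * sin t)\<^sup>2"
    by (simp add: cmod_power2 algebra_simps)
  also have "\<dots> = (A + B)\<^sup>2 - 4 * A * B * (sin t)\<^sup>2"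
    by (simp add: power_mult_distrib sc) (simp add: power2_eq_square algebra_simps)
  also have "\<dots> \<le> (A + B)\<^sup>2 - 2 * (A + B) * m * (sin t)\<^sup>2"
  proof -
    have "A * m \<le> A * B" "m * B \<le> A * B" using assms by (auto intro!: mult_left_mono mult_right_mono)
    then have "2 * (A + B) * m \<le> 4 * A * B" by (simp add: algebra_simps)
    then have "2 * (A + B) * m * (sin t)\<^sup>2 \<le> 4 * A * B * (sin t)\<^sup>2" by (rule mult_right_mono) simp
    then show ?thesis by simp
  qed
  also have "\<dots> \<le> (A + B - m * (sin t)\<^sup>2)\<^sup>2"
    using zero_le_power2[of "m * (sin t)\<^sup>2"] by (simp add: power2_diff)
  finally show "(cmod (of_real A * cis t + of_real B * cis (- t)))\<^sup>2 \<le> (A + B - m * (sin t)\<^sup>2)\<^sup>2" .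
  have "m * (sin t)\<^sup>2 \<le> m * 1" using s1 assms by (intro mult_left_mono) auto
  then show "0 \<le> A + B - m * (sin t)\<^sup>2" using assms by linarith
qed

section \<open>Characters of the discrete torus\<close>

lemma sum_roots_of_unity:
  assumes "L > 0"
  shows "(\<Sum>k<L. cis (- (2 * pi * real k / real L * real_of_int y))) \<in> {0, of_nat L}"
proof -
  define z where "z = cis (- (2 * pi / L * y))"
  have zk: "cis (- (2 * pi * real k / real L * real_of_int y)) = z ^ k" for k
    unfolding z_def Complex.DeMoivre by (simp add: mult_ac)
  have "z ^ L = cis (- (2 * pi * y))"
    using assms by (simp add: z_def Complex.DeMoivre)
  also have "\<dots> = 1" using cis_multiple_2pi[of "- real_of_int y"] by simp
  finally have "z ^ L = 1" .
  then show ?thesis unfolding zk by (cases "z = 1") (auto simp: sum_gp_strict)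
qed

definition torus_character :: "nat \<Rightarrow> ('d::finite \<Rightarrow> nat) \<Rightarrow> int ^ 'd \<Rightarrow> complex" where
  "torus_character L j x = (\<Prod>i\<in>UNIV. cis (- (2 * pi * real (j i) / real L * real_of_int (x $ i))))"

lemma torus_character_minus_axis:
  "torus_character L j (x - axis i s) = cis (2 * pi * real (j i) / real L * real_of_int s) * torus_character L j x"
proof -
  have "torus_character L j (x - axis i s) = (\<Prod>k\<in>UNIV. cis (- (2 * pi * real (j k) / real L * real_of_int (x $ k))) *
      (if k = i then cis (2 * pi * real (j k) / real L * real_of_int s) else 1))"
    unfolding torus_character_def
    by (intro prod.cong) (auto simp: axis_def cis_mult right_diff_distrib)
  then show ?thesis by (simp add: torus_character_def prod.distrib)
qed

lemma norm_torus_character: "cmod (torus_character L j x) = 1"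
  by (simp add: torus_character_def prod_norm[symmetric])

abbreviation torus_frequencies :: "nat \<Rightarrow> ('d::finite \<Rightarrow> nat) set" where
  "torus_frequencies L \<equiv> PiE UNIV (\<lambda>_. {..<L})"

text \<open>The sum factors over coordinates, and each factor is 0 or L. It may be positive at
  nonzero multiples of L, hence the inequality.\<close>

lemma Re_sum_torus_character_ge:
  fixes x :: "int ^ 'd::finite"
  assumes "L > 0"
  shows "of_bool (x = 0) * real L ^ CARD('d) \<le> Re (\<Sum>j\<in>torus_frequencies L. torus_character L j x)"
proof -
  let ?S = "\<lambda>i. \<Sum>k<L. cis (- (2 * pi * real k / real L * real_of_int (x $ i)))"
  have eq: "(\<Sum>j\<in>torus_frequencies L. torus_character L j x) = (\<Prod>i\<in>UNIV. ?S i)"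
    unfolding torus_character_def by (rule prod_sum_PiE[symmetric]) auto
  have real: "?S i = of_real (Re (?S i)) \<and> Re (?S i) \<ge> 0" for i
    using sum_roots_of_unity[OF assms, of "x $ i"] by (elim insertE) (simp_all del: Re_sum)
  have "(\<Prod>i\<in>UNIV. ?S i) = (\<Prod>i\<in>UNIV. of_real (Re (?S i)))"
    using real by (intro prod.cong) blast+
  then have Re_eq: "Re (\<Prod>i\<in>UNIV. ?S i) = (\<Prod>i\<in>UNIV. Re (?S i))"
    by (simp flip: of_real_prod del: Re_sum)
  show ?thesis
  proof (cases "x = 0")
    case True
    then show ?thesis unfolding eq Re_eq by simp
  next
    case False
    then show ?thesis unfolding eq Re_eq using real by (auto intro!: prod_nonneg simp del: Re_sum)
  qed
qed

definition horizontal_symbol :: "nat \<Rightarrow> ('d::finite option \<times> bool \<Rightarrow> real) \<Rightarrow> ('d \<Rightarrow> nat) \<Rightarrow> complex" where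
  "horizontal_symbol L w j = (\<Sum>i\<in>UNIV. of_real (w (Some i, True)) * cis (2 * pi * real (j i) / real L)
     + of_real (w (Some i, False)) * cis (- (2 * pi * real (j i) / real L)))"

text \<open>The right-hand side is the tilted Green's function made \<open>L\<close>-periodic in the horizontal
  coordinates, hence only an inequality.\<close>

lemma tilted_green_le_fourier:
  fixes z :: "'d::finite vertex" and lam a :: real and b :: "real ^ 'd"
  defines "w \<equiv> tilted_weight lam a b"
  assumes L: "L > 0"
  shows "real L ^ CARD('d) * (exp (tilt a b z) * partial_green lam N z) \<le>
    Re (\<Sum>j\<in>torus_frequencies L.
      vertical_transform (w (None, True)) (w (None, False)) (horizontal_symbol L w j) N (fst z)
        * torus_character L j (snd z))"
proof -
  define v where "v j = vertical_transform (w (None, True)) (w (None, False)) (horizontal_symbol L w j)" for j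
  define F where "F N z = (\<Sum>j\<in>torus_frequencies L. v j N (fst z) * torus_character L j (snd z))"
    for N and z :: "'d vertex"
  \<comment> \<open>Each summand satisfies the tilted renewal equation: horizontal shifts multiply
    the character by phases, which \<open>horizontal_symbol\<close> collects.\<close>
  have step: "v j (Suc N) (fst z) * torus_character L j (snd z) =
      of_bool (fst z = 0) * torus_character L j (snd z) +
      (\<Sum>d\<in>UNIV. of_real (w d) * (v j N (fst (z - unit_step d)) * torus_character L j (snd (z - unit_step d))))"
    for j N and z :: "'d vertex"
  proof -
    obtain n x where z: "z = (n, x)" by force
    let ?\<chi> = "torus_character L j" and ?\<rho> = "horizontal_symbol L w j"
    have "?\<rho> * (v j N n * ?\<chi> x) =
        (\<Sum>i\<in>UNIV. of_real (w (Some i, True)) * (v j N n * ?\<chi> (x - axis i 1))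
          + of_real (w (Some i, False)) * (v j N n * ?\<chi> (x - axis i (- 1))))"
      unfolding horizontal_symbol_def sum_distrib_right torus_character_minus_axis
      by (intro sum.cong) (auto simp: algebra_simps)
    moreover have "v j (Suc N) n * ?\<chi> x = of_bool (n = 0) * ?\<chi> x +
        (of_real (w (None, True)) * (v j N (n - 1) * ?\<chi> x)
          + of_real (w (None, False)) * (v j N (n + 1) * ?\<chi> x) + ?\<rho> * (v j N n * ?\<chi> x))"
      by (simp add: v_def algebra_simps)
    ultimately show ?thesis
      unfolding sum_directions z by (simp add: add_ac)
  qed
  have F_Suc: "F (Suc N) z = of_bool (fst z = 0) * (\<Sum>j\<in>torus_frequencies L. torus_character L j (snd z)) +
      (\<Sum>d\<in>UNIV. of_real (w d) * F N (z - unit_step d))" for N z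
    unfolding F_def step sum.distrib
    by (subst sum.swap) (simp add: sum_distrib_left)
  have "real L ^ CARD('d) * (exp (tilt a b z) * partial_green lam N z) \<le> Re (F N z)"
  proof (induction N arbitrary: z)
    case 0
    show ?case by (simp add: F_def v_def)
  next
    case (Suc N)
    have "real L ^ CARD('d) * (exp (tilt a b z) * partial_green lam (Suc N) z)
      = of_bool (z = 0) * real L ^ CARD('d) + (\<Sum>d\<in>UNIV. w d *
         (real L ^ CARD('d) * (exp (tilt a b (z - unit_step d)) * partial_green lam N (z - unit_step d))))"
      by (simp add: partial_green_Suc w_def tilted_weight_def tilt_diff exp_diff
          distrib_left sum_distrib_left mult_ac)
    also have "\<dots> \<le> of_bool (fst z = 0) * Re (\<Sum>j\<in>torus_frequencies L. torus_character L j (snd z)) +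
        (\<Sum>d\<in>UNIV. w d * Re (F N (z - unit_step d)))"
    proof (intro add_mono sum_mono mult_left_mono Suc.IH)
      \<comment> \<open>The summed characters dominate the point source; positivity of the weights
        carries the inequality through the recursion.\<close>
      show "of_bool (z = 0) * real L ^ CARD('d)
          \<le> of_bool (fst z = 0) * Re (\<Sum>j\<in>torus_frequencies L. torus_character L j (snd z))"
        using Re_sum_torus_character_ge[OF L, of "snd z"]
        by (cases "fst z = 0") (simp_all add: prod_eq_iff del: Re_sum)
      show "0 \<le> w d" for d by (simp add: w_def less_imp_le[OF tilted_weight_pos])
    qed
    also have "\<dots> = Re (F (Suc N) z)"
      unfolding F_Suc by simp
    finally show ?case .
  qed
  then show ?thesis by (simp add: F_def v_def)
qed

section \<open>Gaussian upper bound\<close>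

lemma sum_power_dist_le:
  fixes \<rho> :: real
  assumes \<rho>: "0 < \<rho>" "\<rho> < 1"
  shows "(\<Sum>k<N. \<rho> ^ nat \<bar>int k - int c\<bar>) \<le> 2 / (1 - \<rho>)"
proof -
  have geo: "(\<Sum>k<n. \<rho> ^ k) \<le> 1 / (1 - \<rho>)" for n
    using \<rho> by (simp add: sum_gp_strict divide_right_mono)
  have "(\<Sum>k<N. \<rho> ^ nat \<bar>int k - int c\<bar>) \<le> (\<Sum>k\<in>{..<c} \<union> {c..<c + N}. \<rho> ^ nat \<bar>int k - int c\<bar>)"
    using \<rho> by (intro sum_mono2) auto
  also have "\<dots> = (\<Sum>k<c. \<rho> ^ nat \<bar>int k - int c\<bar>) + (\<Sum>k\<in>{c..<c + N}. \<rho> ^ nat \<bar>int k - int c\<bar>)"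
    by (rule sum.union_disjoint) auto
  also have "(\<Sum>k<c. \<rho> ^ nat \<bar>int k - int c\<bar>) = (\<Sum>k<c. \<rho> * \<rho> ^ (c - Suc k))"
  proof (rule sum.cong)
    fix k assume "k \<in> {..<c}"
    \<comment> \<open>To the left of \<open>c\<close> the distances start at 1, so one factor
      \<open>\<rho>\<close> is split off before the sum is reversed.\<close>
    then have "nat \<bar>int k - int c\<bar> = Suc (c - Suc k)" by auto
    then show "\<rho> ^ nat \<bar>int k - int c\<bar> = \<rho> * \<rho> ^ (c - Suc k)" by (simp only: power_Suc)
  qed simp
  also have "\<dots> = \<rho> * (\<Sum>k<c. \<rho> ^ k)"
    by (simp add: sum.nat_diff_reindex flip: sum_distrib_left)
  also have "(\<Sum>k\<in>{c..<c + N}. \<rho> ^ nat \<bar>int k - int c\<bar>) = (\<Sum>k<N. \<rho> ^ k)"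
    by (rule sum.reindex_bij_witness[of _ "\<lambda>k. k + c" "\<lambda>k. k - c"]) (auto simp flip: of_nat_diff)
  also have "\<rho> * (\<Sum>k<c. \<rho> ^ k) \<le> 1 * (1 / (1 - \<rho>))"
    using \<rho> geo[of c] by (intro mult_mono sum_nonneg) auto
  finally show ?thesis using geo[of N] by simp
qed

text \<open>Since |x| \<le> 2, the cubic Taylor error |x|^3 / 6 is at most 2|x| / 3.\<close>

lemma abs_sin_ge:
  fixes x :: real assumes "\<bar>x\<bar> \<le> pi / 2"
  shows "\<bar>x\<bar> / 3 \<le> \<bar>sin x\<bar>"
proof -
  have "\<bar>x\<bar> \<le> 2" using assms pi_less_4 by linarith
  then have "\<bar>x\<bar>\<^sup>2 \<le> 2\<^sup>2" by (intro power_mono) auto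
  then have "\<bar>x\<bar> * \<bar>x\<bar>\<^sup>2 \<le> \<bar>x\<bar> * 4" by (intro mult_left_mono) auto
  then have "\<bar>x\<bar> ^ 3 \<le> 4 * \<bar>x\<bar>" by (simp add: power3_eq_cube power2_eq_square)
  moreover have "\<bar>sin x - x\<bar> \<le> \<bar>x\<bar> ^ 3 / 6"
    using Maclaurin_sin_bound[of x 3] by (simp add: numeral_3_eq_3 sin_coeff_def fact_numeral)
  ultimately show ?thesis by linarith
qed

text \<open>\<open>sin\<^sup>2\<close> has period \<open>\<pi>\<close>, so with \<open>2 l\<close> frequencies it vanishes at \<open>k = 0, l\<close> (and \<open>2 l\<close>).\<close>

lemma sin_squared_lattice_ge:
  assumes l: "l > 0" and k: "k < 2 * l"
  shows "\<exists>t\<in>{0, l, 2 * l}. real (nat \<bar>int k - int t\<bar>) / 3 \<le> (real l)\<^sup>2 * (sin (2 * pi * real k / real (2 * l)))\<^sup>2"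
proof -
  \<comment> \<open>\<open>m * l\<close> is the multiple of \<open>l\<close> nearest to
    \<open>k\<close>.\<close>
  obtain m :: nat where m: "m \<le> 2" "\<bar>real k - real (m * l)\<bar> \<le> real l / 2"
  proof -
    consider "2 * k \<le> l" | "l < 2 * k" "2 * k \<le> 3 * l" | "3 * l < 2 * k" by linarith
    then show thesis
    proof cases
      case 1 then show ?thesis by (intro that[of 0]) auto
    next
      case 2
      then have "real l < real (2 * k)" "real (2 * k) \<le> real (3 * l)"
        by (simp_all only: of_nat_less_iff of_nat_le_iff)
      then show ?thesis by (intro that[of 1]) (auto simp: abs_if)
    next
      case 3 then show ?thesis using k by (intro that[of 2]) auto
    qed
  qed
  define u where "u = real k - real (m * l)"
  define y where "y = pi * u / real l"
  have "2 * pi * real k / real (2 * l) = y + real m * pi"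
    using l by (simp add: y_def u_def field_simps)
  then have "(sin (2 * pi * real k / real (2 * l)))\<^sup>2 = (sin y)\<^sup>2"
    by (simp add: sin_add sin_npi cos_npi power_mult_distrib flip: power_mult)
  moreover have "(y / 3)\<^sup>2 \<le> (sin y)\<^sup>2"
  proof -
    have "\<bar>y\<bar> = pi / l * \<bar>u\<bar>" using l by (simp add: y_def abs_mult)
    also have "\<dots> \<le> pi / l * (l / 2)" using m(2) by (intro mult_left_mono) (auto simp: u_def)
    finally have "\<bar>y\<bar> / 3 \<le> \<bar>sin y\<bar>" using l by (intro abs_sin_ge) simp
    then have "(\<bar>y\<bar> / 3)\<^sup>2 \<le> \<bar>sin y\<bar>\<^sup>2" by (intro power_mono) auto
    then show ?thesis by (simp add: power_divide)
  qed
  ultimately have "(real l)\<^sup>2 * (y / 3)\<^sup>2 \<le> (real l)\<^sup>2 * (sin (2 * pi * real k / real (2 * l)))\<^sup>2"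
    by (simp add: mult_left_mono)
  moreover have "(real l)\<^sup>2 * (y / 3)\<^sup>2 = pi\<^sup>2 / 9 * u\<^sup>2"
    using l by (simp add: y_def power_mult_distrib power_divide)
  moreover have "\<bar>u\<bar> / 3 \<le> pi\<^sup>2 / 9 * u\<^sup>2"
  proof -
    define e where "e = nat \<bar>int k - int (m * l)\<bar>"
    have ue: "\<bar>u\<bar> = real e" unfolding u_def e_def by simp
    \<comment> \<open>An integer distance is at most its square, so the quadratic exponent may be
      weakened to a linear one, which leads to geometric series.\<close>
    have "real e \<le> (real e)\<^sup>2"
      unfolding of_nat_power[symmetric] of_nat_le_iff by (simp add: power2_eq_square)
    moreover have "1 / 3 \<le> pi\<^sup>2 / 9" using power_mono[OF pi_ge_two, of 2] by simp
    ultimately have "1 / 3 * real e \<le> pi\<^sup>2 / 9 * (real e)\<^sup>2" by (intro mult_mono) auto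
    then show ?thesis using ue by (metis mult.commute power2_abs times_divide_eq_left mult_1)
  qed
  moreover have "real (nat \<bar>int k - int (m * l)\<bar>) = \<bar>u\<bar>" by (simp add: u_def)
  moreover have "m * l \<in> {0, l, 2 * l}" using m(1) by (cases "m = 0"; cases "m = 1") auto
  ultimately show ?thesis by (intro bexI[of _ "m * l"]) auto
qed

text \<open>The terms decay geometrically away from the zeros 0, l and 2l of the sine, so three
  geometric series bound the sum uniformly in \<open>l\<close> and \<open>n\<close>. Averaging over
  2l frequencies with l of order sqrt n then gains a factor of order 1 / sqrt n per
  coordinate.\<close>

lemma lattice_gaussian_sum_le:
  fixes c :: real
  assumes c: "c > 0" and l: "l > 0" and n: "(real l)\<^sup>2 \<le> n"
  shows "(\<Sum>k<2 * l. exp (- c * n * (sin (2 * pi * real k / real (2 * l)))\<^sup>2)) \<le> 6 / (1 - exp (- c / 3))"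
proof -
  define \<rho> where "\<rho> = exp (- c / 3)"
  have \<rho>: "0 < \<rho>" "\<rho> < 1" using c by (auto simp: \<rho>_def)
  let ?g = "\<lambda>t k. \<rho> ^ nat \<bar>int k - int t\<bar>"
  have "exp (- c * n * (sin (2 * pi * real k / real (2 * l)))\<^sup>2) \<le> ?g 0 k + ?g l k + ?g (2 * l) k"
    if "k < 2 * l" for k
  proof -
    let ?s = "(sin (2 * pi * real k / real (2 * l)))\<^sup>2"
    obtain t where t: "t \<in> {0, l, 2 * l}" "real (nat \<bar>int k - int t\<bar>) / 3 \<le> (real l)\<^sup>2 * ?s"
      using sin_squared_lattice_ge[OF l \<open>k < 2 * l\<close>] by blast
    have "real (nat \<bar>int k - int t\<bar>) / 3 \<le> n * ?s"
      using t(2) mult_right_mono[OF n, of ?s] by simp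
    then have "c * (real (nat \<bar>int k - int t\<bar>) / 3) \<le> c * (n * ?s)"
      using c by (intro mult_left_mono) auto
    then have "exp (- c * n * ?s) \<le> exp (real (nat \<bar>int k - int t\<bar>) * (- c / 3))"
      by (intro exp_mono) (simp add: algebra_simps)
    also have "\<dots> = ?g t k" unfolding exp_of_nat_mult \<rho>_def ..
    also have "\<dots> \<le> ?g 0 k + ?g l k + ?g (2 * l) k"
    proof -
      have "?g 0 k \<ge> 0" "?g l k \<ge> 0" "?g (2 * l) k \<ge> 0" using \<rho> by auto
      with t(1) show ?thesis by (elim insertE emptyE; hypsubst; linarith)
    qed
    finally show ?thesis .
  qed
  then have "(\<Sum>k<2 * l. exp (- c * n * (sin (2 * pi * real k / real (2 * l)))\<^sup>2))
      \<le> (\<Sum>k<2 * l. ?g 0 k + ?g l k + ?g (2 * l) k)"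
    by (intro sum_mono) auto
  also have "\<dots> \<le> 2 / (1 - \<rho>) + 2 / (1 - \<rho>) + 2 / (1 - \<rho>)"
    unfolding sum.distrib by (intro add_mono sum_power_dist_le \<rho>)
  finally show ?thesis by (simp add: \<rho>_def)
qed

lemma green_le_gaussian:
  assumes "lam > 0"
  shows "\<exists>c>0. \<exists>c'>0. \<forall>n. \<forall>x :: int ^ 'd::finite. 1 \<le> n \<longrightarrow> norm (real_vec x) \<le> real_of_int n \<longrightarrow>
    green lam 0 (n, x) \<le> ennreal (c * (exp (- c' * (norm (real_vec x))\<^sup>2 / real_of_int n)
      / sqrt n ^ CARD('d)))"
proof -
  let ?q = "rest_prob TYPE('d) lam" and ?\<delta> = "drift TYPE('d) lam"
  \<comment> \<open>The tilted ratio of downward to upward weight is exp (2a - lam), at most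
    \<alpha> because 2a \<le> lam/2. \<open>m\<close> bounds every tilted weight below via exp (-1)
    \<ge> 1/3; 1/C is the slack at height 0; \<open>K\<close> bounds the frequency sum of one
    coordinate.\<close>
  define \<alpha> where "\<alpha> = exp (- lam / 2)"
  define m where "m = ?q / 3"
  define C where "C = 1 / (m * (1 - \<alpha>))"
  define K where "K = 6 / (1 - exp (- (m / 2) / 3))"
  have \<alpha>: "0 < \<alpha>" "\<alpha> < 1" using assms by (auto simp: \<alpha>_def)
  have \<delta>: "0 < ?\<delta>" "?\<delta> \<le> 1" "?\<delta> \<le> lam" using drift_pos drift_bounds assms by blast+
  have q: "?q > 0" by (rule rest_prob_pos)
  have m: "m > 0" using q by (simp add: m_def)
  have C: "C > 0" using m \<alpha> by (simp add: C_def)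
  have K: "K > 0" using m by (simp add: K_def)
  have "green lam 0 (n, x) \<le> ennreal (C * K ^ CARD('d) * (exp (- (?\<delta> / 8) * (norm (real_vec x))\<^sup>2 / n)
      / sqrt n ^ CARD('d)))"
    if n: "1 \<le> n" and xn: "norm (real_vec x) \<le> real_of_int n" for n and x :: "int ^ 'd"
  proof (rule green_le)
    fix N
    define R where "R = norm (real_vec x)"
    define t where "t = (R / n)\<^sup>2"
    \<comment> \<open>The exponent at (n, x) is \<open>?\<delta>\<close> R^2/(4n) -
      \<open>?\<delta>\<close> R^2/(8n) > 0 for R > 0, while the moment bound changes by
      \<open>?\<delta>\<close>^2 (- t/8 + t^2/64 + t/16) \<le> 0 since t \<le> 1.\<close>
    define a where "a = ?\<delta> * t / 8"
    define b where "b = (?\<delta> / (4 * n)) *\<^sub>R real_vec x"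
    define w where "w = tilted_weight lam a b"
    \<comment> \<open>Rounding down gives l^2 \<le> n for the frequency sum; doubling gives L \<ge>
      sqrt n for the final division.\<close>
    define l where "l = nat \<lfloor>sqrt n\<rfloor>"
    define L where "L = 2 * l"
    let ?s = "\<lambda>k. (sin (2 * pi * real k / real L))\<^sup>2"
    have R: "0 \<le> R / n" "R / n \<le> 1" using n xn by (auto simp: R_def)
    have t: "0 \<le> t" "t \<le> 1" using R by (auto simp: t_def power_le_one)
    have "0 \<le> ?\<delta> * t" "?\<delta> * t \<le> ?\<delta> * 1"
      using \<delta> t by (auto intro!: mult_left_mono simp del: mult_1_right)
    then have a: "0 \<le> a" "a \<le> 1" "2 * a \<le> lam / 2"
      using \<delta> unfolding a_def by linarith+
    have nb: "norm b = ?\<delta> / 4 * (R / n)" using n \<delta> by (simp add: b_def R_def)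
    have "?\<delta> / 4 * (R / n) \<le> 1 * 1" using \<delta> R by (intro mult_mono) auto
    then have nb1: "norm b \<le> 1" unfolding nb by simp
    have tilt: "tilt a b (n, x) = ?\<delta> / 8 * R\<^sup>2 / n"
      unfolding b_def tilt_scaled using n by (simp add: a_def t_def R_def field_simps power2_eq_square)
    have "(\<Sum>d\<in>UNIV. w d) \<le> 1 - ?\<delta> * a + a\<^sup>2 + (norm b)\<^sup>2"
      unfolding w_def using a nb1 by (intro sum_tilted_weight_le) auto
    also have "\<dots> = 1 - ?\<delta>\<^sup>2 * (t / 16 - t * t / 64)"
      unfolding nb power_mult_distrib t_def[symmetric] by (simp add: a_def power2_eq_square algebra_simps)
    also have "\<dots> \<le> 1"
    proof -
      have "t * t \<le> t * 1" using t by (intro mult_left_mono) auto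
      then have "t / 16 - t * t / 64 \<ge> 0" using t by linarith
      then show ?thesis by simp
    qed
    finally have sum_w: "(\<Sum>d\<in>UNIV. w d) \<le> 1" .
    have w_m: "m \<le> w d" for d
    proof -
      have "- 1 \<le> tilt a b (unit_step d)"
      proof (cases d rule: unit_step.cases)
        case (1 s)
        then show ?thesis using a unfolding 1 tilt_unit_step by auto
      next
        case (2 i s)
        have "\<bar>b $ i\<bar> \<le> 1" using component_le_norm_cart[of b i] nb1 by linarith
        then show ?thesis unfolding 2 tilt_unit_step by auto
      qed
      then have "exp (- 1) \<le> exp (tilt a b (unit_step d))" by (rule exp_mono)
      moreover have "1 / 3 \<le> exp (- 1 :: real)"
        unfolding exp_minus inverse_eq_divide by (rule divide_left_mono[OF exp_le]) auto
      ultimately have "1 / 3 \<le> exp (tilt a b (unit_step d))" by linarith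
      then have "?q * (1 / 3) \<le> step_prob lam d * exp (tilt a b (unit_step d))"
        using q rest_prob_le_step_prob[OF assms, of d] by (intro mult_mono) auto
      then show ?thesis by (simp add: m_def w_def tilted_weight_def)
    qed
    let ?wp = "w (None, True)" and ?wm = "w (None, False)"
    have wm_le: "?wm \<le> \<alpha> * ?wp"
    proof -
      have "exp a \<le> exp (- lam / 2 + lam - a)" using a by (intro exp_mono) linarith
      also have "\<dots> = \<alpha> * (exp lam * exp (- a))" by (simp add: \<alpha>_def flip: exp_add)
      finally have "?q * exp a \<le> ?q * (\<alpha> * (exp lam * exp (- a)))"
        using q by (intro mult_left_mono) auto
      then show ?thesis
        unfolding w_def tilted_weight_def tilt_unit_step by (simp add: step_prob_eq mult_ac)
    qed
    define W where "W = (\<Sum>i\<in>UNIV. w (Some i, True) + w (Some i, False))"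
    have total: "?wp + ?wm + W \<le> 1" using sum_w unfolding sum_directions W_def by simp
    have wpos: "?wp > 0" "?wm > 0" using w_m m by (meson less_le_trans)+
    have W: "W \<ge> 0" unfolding W_def using w_m m by (intro sum_nonneg add_nonneg_nonneg) (meson less_imp_le order.trans)+
    have transform_le: "cmod (vertical_transform ?wp ?wm (horizontal_symbol L w j) N n)
        \<le> C * (\<Prod>i\<in>UNIV. exp (- (m / 2) * n * ?s (j i)))" for j
    proof -
      \<comment> \<open>The killing rate at frequency \<open>j\<close>.\<close>
      define \<kappa> where "\<kappa> = m * (\<Sum>i\<in>UNIV. ?s (j i))"
      have \<kappa>0: "\<kappa> \<ge> 0" unfolding \<kappa>_def using m by (intro mult_nonneg_nonneg sum_nonneg) auto
      have "cmod (horizontal_symbol L w j) \<le> (\<Sum>i\<in>UNIV. w (Some i, True) + w (Some i, False) - m * ?s (j i))"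
        unfolding horizontal_symbol_def
        by (intro order.trans[OF norm_sum] sum_mono norm_cis_combination_le m w_m)
      also have "\<dots> = W - \<kappa>" by (simp add: W_def \<kappa>_def sum_subtractf sum_distrib_left)
      finally have symbol: "cmod (horizontal_symbol L w j) \<le> W - \<kappa>" .
      have \<kappa>1: "\<kappa> \<le> 1" using symbol norm_ge_zero[of "horizontal_symbol L w j"] total wpos by linarith
      have "cmod (vertical_transform ?wp ?wm (horizontal_symbol L w j) N n) \<le>
          C * (if n \<ge> 0 then exp (- (\<kappa> / 2) * n) else \<alpha> ^ nat (- n))"
      proof (rule norm_vertical_transform_le[where r = "W - \<kappa>"])
        \<comment> \<open>Decay rate \<kappa>/2 is affordable: exp (\<kappa>/2) \<le> 1 + \<kappa>,
          so the upward term grows by at most \<kappa>, exactly what the horizontal part has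
          lost.\<close>
        have "exp (\<kappa> / 2) \<le> 1 + \<kappa> / 2 + (\<kappa> / 2)\<^sup>2" using \<kappa>0 \<kappa>1 by (intro exp_bound) auto
        also have "(\<kappa> / 2)\<^sup>2 \<le> \<kappa> / 2 * 1" unfolding power2_eq_square using \<kappa>0 \<kappa>1 by (intro mult_left_mono) auto
        finally have "exp (\<kappa> / 2) \<le> 1 + \<kappa>" by simp
        then have "?wp * exp (\<kappa> / 2) \<le> ?wp * (1 + \<kappa>)" using wpos by (intro mult_left_mono) auto
        moreover have "?wp * \<kappa> \<le> 1 * \<kappa>" using \<kappa>0 total wpos W by (intro mult_right_mono) linarith+
        moreover have wm1: "?wm * exp (- (\<kappa> / 2)) \<le> ?wm * 1" using wpos \<kappa>0 by (intro mult_left_mono) auto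
        ultimately show "?wp * exp (\<kappa> / 2) + ?wm * exp (- (\<kappa> / 2)) + (W - \<kappa>) \<le> 1"
          using total by (simp add: distrib_left)
        \<comment> \<open>Below height 0 the upward bias compensates: what dividing
          \<open>?wm\<close> by \<alpha> adds is at most what multiplying \<open>?wp\<close> by
          \<alpha> removes.\<close>
        have "?wm / \<alpha> \<le> ?wp" using wm_le \<alpha> by (simp add: pos_divide_le_eq mult.commute)
        then have "(1 - \<alpha>) * (?wm / \<alpha>) \<le> (1 - \<alpha>) * ?wp" using \<alpha> by (intro mult_left_mono) auto
        moreover have "(1 - \<alpha>) * (?wm / \<alpha>) = ?wm / \<alpha> - ?wm" using \<alpha> by (simp add: field_simps)
        ultimately show "?wp * \<alpha> + ?wm / \<alpha> + (W - \<kappa>) \<le> 1"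
          using total \<kappa>0 by (simp add: algebra_simps)
        have "(1 - \<alpha>) * m \<le> (1 - \<alpha>) * ?wp" using \<alpha> w_m by (intro mult_left_mono) auto
        moreover have "1 / C = (1 - \<alpha>) * m" by (simp add: C_def mult.commute)
        ultimately show "?wp * \<alpha> + ?wm * exp (- (\<kappa> / 2)) + (W - \<kappa>) \<le> 1 - 1 / C"
          using total \<kappa>0 wm1 by (simp add: algebra_simps)
      qed (use wpos symbol C \<alpha> in auto)
      also have "(if n \<ge> 0 then exp (- (\<kappa> / 2) * n) else \<alpha> ^ nat (- n)) = exp (\<Sum>i\<in>UNIV. - (m / 2) * n * ?s (j i))"
        using n unfolding \<kappa>_def sum_distrib_left[symmetric] by simp
      also have "\<dots> = (\<Prod>i\<in>UNIV. exp (- (m / 2) * n * ?s (j i)))" by (rule exp_sum) simp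
      finally show ?thesis .
    qed
    have sqrtn: "sqrt n \<ge> 1" using n by simp
    have l: "l \<ge> 1" "real l \<le> sqrt n" "sqrt n \<le> real l + 1"
      using sqrtn by (auto simp: l_def le_nat_iff of_nat_nat le_floor_iff)
    have L: "L > 0" "sqrt n \<le> real L" using l by (auto simp: L_def)
    have "(real l)\<^sup>2 \<le> (sqrt n)\<^sup>2" using l by (intro power_mono) auto
    then have ln: "(real l)\<^sup>2 \<le> n" using n by simp
    have "real L ^ CARD('d) * (exp (tilt a b (n, x)) * partial_green lam N (n, x))
        \<le> Re (\<Sum>j\<in>torus_frequencies L. vertical_transform ?wp ?wm (horizontal_symbol L w j) N n * torus_character L j x)"
      using tilted_green_le_fourier[OF L(1), where lam = lam and a = a and b = b and z = "(n, x)" and N = N]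
      by (simp only: w_def fst_conv snd_conv)
    also have "\<dots> \<le> (\<Sum>j\<in>torus_frequencies L. C * (\<Prod>i\<in>(UNIV :: 'd set). exp (- (m / 2) * n * ?s (j i))))"
    proof -
      let ?f = "\<lambda>j. vertical_transform ?wp ?wm (horizontal_symbol L w j) N n * torus_character L j x"
      have "Re (\<Sum>j\<in>torus_frequencies L. ?f j) \<le> cmod (\<Sum>j\<in>torus_frequencies L. ?f j)"
        by (rule complex_Re_le_cmod)
      also have "\<dots> \<le> (\<Sum>j\<in>torus_frequencies L. cmod (?f j))" by (rule norm_sum)
      also have "\<dots> \<le> (\<Sum>j\<in>torus_frequencies L. C * (\<Prod>i\<in>(UNIV :: 'd set). exp (- (m / 2) * n * ?s (j i))))"
      proof (rule sum_mono)
        fix j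
        show "cmod (?f j) \<le> C * (\<Prod>i\<in>(UNIV :: 'd set). exp (- (m / 2) * n * ?s (j i)))"
          unfolding norm_mult norm_torus_character mult_1_right by (rule transform_le)
      qed
      finally show ?thesis .
    qed
    also have "\<dots> = C * (\<Prod>i\<in>(UNIV :: 'd set). \<Sum>k<L. exp (- (m / 2) * n * ?s k))"
      by (subst prod_sum_PiE) (auto simp: sum_distrib_left)
    also have "\<dots> = C * (\<Sum>k<L. exp (- (m / 2) * n * ?s k)) ^ CARD('d)" by simp
    also have "\<dots> \<le> C * K ^ CARD('d)"
      unfolding K_def L_def using m l ln C
      by (intro mult_left_mono power_mono lattice_gaussian_sum_le sum_nonneg) auto
    finally have main: "real L ^ CARD('d) * (exp (tilt a b (n, x)) * partial_green lam N (n, x)) \<le> C * K ^ CARD('d)" .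
    have "sqrt n ^ CARD('d) * (exp (tilt a b (n, x)) * partial_green lam N (n, x))
        \<le> real L ^ CARD('d) * (exp (tilt a b (n, x)) * partial_green lam N (n, x))"
      using L sqrtn by (intro mult_right_mono power_mono mult_nonneg_nonneg partial_green_nonneg) auto
    also note main
    finally have "partial_green lam N (n, x) \<le> C * K ^ CARD('d) * (exp (- tilt a b (n, x)) / sqrt n ^ CARD('d))"
      using sqrtn by (simp add: exp_minus field_simps)
    then show "partial_green lam N (n, x) \<le> C * K ^ CARD('d) * (exp (- (?\<delta> / 8) * (norm (real_vec x))\<^sup>2 / n) / sqrt n ^ CARD('d))"
      by (simp add: tilt R_def)
  qed
  moreover have "C * K ^ CARD('d) > 0" using C K by simp
  ultimately show ?thesis using \<delta> by (intro exI[of _ "C * K ^ CARD('d)"] conjI exI[of _ "?\<delta> / 8"]) auto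
qed

section \<open>The two-sided estimate\<close>

lemma sqrt_power_conv_powr:
  assumes "r > 0"
  shows "1 / sqrt r ^ k = r powr (- real k / 2)"
proof -
  have "r powr (real k / 2) = (r powr (1 / 2)) powr real k" by (simp add: powr_powr)
  also have "\<dots> = sqrt r ^ k" using assms by (simp add: powr_half_sqrt powr_realpow)
  finally show ?thesis
    unfolding minus_divide_left[symmetric] powr_minus_divide by simp
qed

text \<open>Inside the cone, n \<le> norm z \<le> 2n, so powers of n and of norm z are
  comparable.\<close>

lemma norm_powr_comparison:
  fixes n :: int and x :: "int ^ 'd::finite"
  assumes n: "1 \<le> n" and xn: "norm (real_vec x) \<le> real_of_int n"
  shows "norm (real_vertex (n, x)) powr (- real CARD('d) / 2) \<le> 1 / sqrt n ^ CARD('d)"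
    and "1 / sqrt n ^ CARD('d) \<le> 2 powr (real CARD('d) / 2) * norm (real_vertex (n, x)) powr (- real CARD('d) / 2)"
proof -
  let ?z = "norm (real_vertex (n, x))" and ?e = "- real CARD('d) / 2"
  have conv: "1 / sqrt n ^ CARD('d) = real_of_int n powr ?e"
    using n by (intro sqrt_power_conv_powr) simp
  have nz: "real_of_int n \<le> ?z"
    using norm_fst_le[of "real_of_int n" "real_vec x"] n by (simp add: real_vertex_def)
  then show "?z powr ?e \<le> 1 / sqrt n ^ CARD('d)"
    unfolding conv using n by (intro powr_mono2') auto
  have "?z \<le> 2 * n"
    using norm_Pair_le[of "real_of_int n" "real_vec x"] n xn by (simp add: real_vertex_def)
  then have "(2 * real_of_int n) powr ?e \<le> ?z powr ?e"
    using n nz by (intro powr_mono2') auto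
  then have "2 powr (real CARD('d) / 2) * (2 powr ?e * real_of_int n powr ?e) \<le> 2 powr (real CARD('d) / 2) * ?z powr ?e"
    using n by (intro mult_left_mono) (auto simp: powr_mult)
  moreover have one: "2 powr (real CARD('d) / 2) * 2 powr ?e = 1"
    by (simp flip: powr_add)
  have "2 powr (real CARD('d) / 2) * (2 powr ?e * real_of_int n powr ?e) = real_of_int n powr ?e"
    by (simp only: mult.assoc[symmetric] one mult_1_left)
  ultimately show "1 / sqrt n ^ CARD('d) \<le> 2 powr (real CARD('d) / 2) * ?z powr ?e"
    unfolding conv by linarith
qed

theorem mainTheorem1:
  fixes lam :: real
  assumes "lam > 0"
  shows "\<exists>c1 c2 c3 c4 :: real. c1 > 0 \<and> c2 > 0 \<and> c3 > 0 \<and> c4 > 0 \<and>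
    (\<forall>(n :: int) (x :: int ^ 'd::finite). (n, x) \<noteq> 0 \<longrightarrow>
      green lam 0 (n, x) \<le> ennreal (c1 *
        (if norm (real_vec x) > real_of_int n
         then exp (- c2 * norm (real_vertex (n, x)))
         else exp (- c2 * (norm (real_vec x))\<^sup>2 / real_of_int n)
              * norm (real_vertex (n, x)) powr (- real CARD('d) / 2))) \<and>
      green lam 0 (n, x) \<ge> ennreal (c3 *
        (if norm (real_vec x) > real_of_int n
         then exp (- c4 * norm (real_vertex (n, x)))
         else exp (- c4 * (norm (real_vec x))\<^sup>2 / real_of_int n)
              * norm (real_vertex (n, x)) powr (- real CARD('d) / 2))))"
proof -
  let ?z = "\<lambda>n (x :: int ^ 'd). norm (real_vertex (n, x))"
  let ?e = "- real CARD('d) / 2"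
  obtain u1 u2 where u: "u1 > 0" "u2 > 0"
    and upper_far: "\<And>n (x :: int ^ 'd). norm (real_vec x) > real_of_int n \<Longrightarrow>
      green lam 0 (n, x) \<le> ennreal (u1 * exp (- u2 * ?z n x))"
    using green_le_exp[OF assms, where 'd = 'd] by blast
  obtain g1 g2 where g: "g1 > 0" "g2 > 0"
    and upper_near: "\<And>n (x :: int ^ 'd). 1 \<le> n \<Longrightarrow> norm (real_vec x) \<le> real_of_int n \<Longrightarrow>
      green lam 0 (n, x) \<le> ennreal (g1 * (exp (- g2 * (norm (real_vec x))\<^sup>2 / n) / sqrt n ^ CARD('d)))"
    using green_le_gaussian[OF assms, where 'd = 'd] by blast
  obtain v where v: "v > 0"
    and lower_far: "\<And>z :: 'd vertex. green lam 0 z \<ge> ennreal (exp (- v * norm (real_vertex z)))"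
    using green_ge_exp[OF assms, where 'd = 'd] by blast
  obtain h1 h2 where h: "h1 > 0" "h2 > 0"
    and lower_near: "\<And>n (x :: int ^ 'd). 1 \<le> n \<Longrightarrow> norm (real_vec x) \<le> real_of_int n \<Longrightarrow>
      green lam 0 (n, x) \<ge> ennreal (h1 * (exp (- h2 * (norm (real_vec x))\<^sup>2 / n) / sqrt n ^ CARD('d)))"
    using green_ge_gaussian[OF assms, where 'd = 'd] by blast
  \<comment> \<open>Each constant serves both regimes; the power of 2 comes from replacing n by the
    norm of z in the near regime.\<close>
  define c1 where "c1 = max u1 (g1 * 2 powr (real CARD('d) / 2))"
  define c2 where "c2 = min u2 g2"
  define c3 where "c3 = min 1 h1"
  define c4 where "c4 = max v h2"
  have pos: "c1 > 0" "c2 > 0" "c3 > 0" "c4 > 0"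
    using u g v h by (auto simp: c1_def c2_def c3_def c4_def)
  have far: "green lam 0 (n, x) \<le> ennreal (c1 * exp (- c2 * ?z n x))"
      "green lam 0 (n, x) \<ge> ennreal (c3 * exp (- c4 * ?z n x))"
    if "norm (real_vec x) > real_of_int n" for n x
  proof -
    have "c2 * ?z n x \<le> u2 * ?z n x" "v * ?z n x \<le> c4 * ?z n x"
      by (rule mult_right_mono; simp add: c2_def c4_def)+
    then have exps: "exp (- u2 * ?z n x) \<le> exp (- c2 * ?z n x)" "exp (- c4 * ?z n x) \<le> exp (- v * ?z n x)"
      by (simp_all only: exp_le_cancel_iff mult_minus_left neg_le_iff_le)
    have "u1 * exp (- u2 * ?z n x) \<le> c1 * exp (- c2 * ?z n x)"
      using u by (intro mult_mono exps) (auto simp: c1_def)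
    then show "green lam 0 (n, x) \<le> ennreal (c1 * exp (- c2 * ?z n x))"
      using upper_far[OF that] ennreal_leI order.trans by blast
    have "c3 * exp (- c4 * ?z n x) \<le> 1 * exp (- v * ?z n x)"
      by (intro mult_mono exps) (auto simp: c3_def)
    then have "ennreal (c3 * exp (- c4 * ?z n x)) \<le> ennreal (exp (- v * ?z n x))"
      by (intro ennreal_leI) simp
    then show "green lam 0 (n, x) \<ge> ennreal (c3 * exp (- c4 * ?z n x))"
      using lower_far order.trans by blast
  qed
  have near: "green lam 0 (n, x) \<le> ennreal (c1 * (exp (- c2 * (norm (real_vec x))\<^sup>2 / n) * ?z n x powr ?e))"
      "green lam 0 (n, x) \<ge> ennreal (c3 * (exp (- c4 * (norm (real_vec x))\<^sup>2 / n) * ?z n x powr ?e))"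
    if n: "1 \<le> n" and xn: "norm (real_vec x) \<le> real_of_int n" for n x
  proof -
    let ?R = "(norm (real_vec x))\<^sup>2 / n"
    have R: "?R \<ge> 0" using n by simp
    have "c2 * ?R \<le> g2 * ?R" "h2 * ?R \<le> c4 * ?R"
      using R by (intro mult_right_mono; simp add: c2_def c4_def)+
    then have exps: "exp (- g2 * ?R) \<le> exp (- c2 * ?R)" "exp (- c4 * ?R) \<le> exp (- h2 * ?R)"
      by (simp_all only: exp_le_cancel_iff mult_minus_left neg_le_iff_le)
    have "g1 * (exp (- g2 * ?R) / sqrt n ^ CARD('d))
        = g1 * (exp (- g2 * ?R) * (1 / sqrt n ^ CARD('d)))" by simp
    also have "\<dots> \<le> g1 * (exp (- c2 * ?R) * (2 powr (real CARD('d) / 2) * ?z n x powr ?e))"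
      using g n by (intro mult_left_mono mult_mono norm_powr_comparison(2)[OF n xn] exps) auto
    also have "\<dots> = g1 * 2 powr (real CARD('d) / 2) * (exp (- c2 * ?R) * ?z n x powr ?e)" by simp
    also have "\<dots> \<le> c1 * (exp (- c2 * ?R) * ?z n x powr ?e)"
      by (intro mult_right_mono) (auto simp: c1_def)
    finally show "green lam 0 (n, x) \<le> ennreal (c1 * (exp (- c2 * (norm (real_vec x))\<^sup>2 / n) * ?z n x powr ?e))"
      using upper_near[OF n xn] ennreal_leI order.trans unfolding times_divide_eq_right by blast
    have "c3 * (exp (- c4 * ?R) * ?z n x powr ?e) \<le> h1 * (exp (- h2 * ?R) * (1 / sqrt n ^ CARD('d)))"
      using h by (intro mult_mono norm_powr_comparison(1)[OF n xn] exps) (auto simp: c3_def)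
    also have "\<dots> = h1 * (exp (- h2 * ?R) / sqrt n ^ CARD('d))" by simp
    finally show "green lam 0 (n, x) \<ge> ennreal (c3 * (exp (- c4 * (norm (real_vec x))\<^sup>2 / n) * ?z n x powr ?e))"
      using lower_near[OF n xn] ennreal_leI order.trans unfolding times_divide_eq_right by blast
  qed
  \<comment> \<open>If n \<le> 0, then 0 \<le> norm x \<le> n forces z = 0; the second regime
    therefore has n \<ge> 1, and its quotient by n is a genuine one.\<close>
  have n_pos: "1 \<le> n" if "(n, x) \<noteq> 0" "\<not> norm (real_vec x) > real_of_int n" for n and x :: "int ^ 'd"
  proof (rule ccontr)
    assume "\<not> 1 \<le> n"
    then have "real_of_int n \<le> 0" by simp
    with that(2) norm_ge_zero[of "real_vec x"] have "norm (real_vec x) = 0" "real_of_int n = 0" by linarith+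
    then have "n = 0" "x = 0" by (auto simp: real_vec_def vec_eq_iff)
    with that(1) show False by (simp add: zero_prod_def)
  qed
  show ?thesis
  proof (rule exI[of _ c1], rule exI[of _ c2], rule exI[of _ c3], rule exI[of _ c4],
      intro conjI pos allI impI)
    fix n :: int and x :: "int ^ 'd" assume nx: "(n, x) \<noteq> 0"
    show "green lam 0 (n, x) \<le> ennreal (c1 *
        (if norm (real_vec x) > real_of_int n then exp (- c2 * ?z n x)
         else exp (- c2 * (norm (real_vec x))\<^sup>2 / real_of_int n) * ?z n x powr ?e))"
      using far(1)[of n x] near(1)[of n x] n_pos[OF nx] by (simp add: not_less)
    show "green lam 0 (n, x) \<ge> ennreal (c3 *
        (if norm (real_vec x) > real_of_int n then exp (- c4 * ?z n x)
         else exp (- c4 * (norm (real_vec x))\<^sup>2 / real_of_int n) * ?z n x powr ?e))"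
      using far(2)[of n x] near(2)[of n x] n_pos[OF nx] by (simp add: not_less)
  qed
qed

end
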